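(* Assume that $f\in L^2(\Omega)$. If $\sigma$ is a positive function in $\overline{\Omega}$, then the variational problem: find $\Phi\in V^c$ such that $$a(\Phi,v)=L(v)\qquad\text{for all } v\in V^c$$ is well-posed.
   Context: Let $\Omega=(0,L)^2$ with $L>0$, $\Gamma_1=\{(x,y)\in\partial\Omega: x=0\}$, $\Gamma_2=\{(x,y)\in\partial\Omega: y=0\text{ or }y=L\}$, $\Gamma_3=\{(x,y)\in\partial\Omega: x=L\}$, and let $|\Gamma_1|$ be the length of $\Gamma_1$. The function $\sigma$ is the conductivity, $f$ is a spatial charge distribution, the constant $U\in\mathbb{R}$ is the voltage, and the constant $R>0$ is the resistance. Let $$V^c=\{\Phi\in H^1(\Omega): \Phi|_{\Gamma_1}\text{ is a constant function},\ \Phi|_{\Gamma_3}=0\},$$ where the value of the constant on $\Gamma_1$ is not prescribed and may depend on $\Phi$. Define, for $\Phi,v\in V^c$, $$a(\Phi,v)=\int_\Omega \sigma\nabla\Phi\cdot\nabla v\,dx+\frac{1}{|\Gamma_1|R}\int_{\Gamma_1}\Phi v\,ds,\qquad L(v)=\int_\Omega f v\,dx+\frac{U}{|\Gamma_1|R}\int_{\Gamma_1}v\,ds.$$ (The functional $L(\cdot)$ is distinct from the side length $L$.) This is the variational form, taking $\Phi_D=0$ without loss of generality, of the boundary value problem $-\nabla\cdot(\sigma\nabla\Phi)=f$ in $\Omega$, $\Phi=U-R\int_{\Gamma_1}\sigma\frac{\partial\Phi}{\partial n}\,ds$ on $\Gamma_1$, $\sigma\frac{\partial\Phi}{\partial n}=0$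 on $\Gamma_2$, $\Phi=\Phi_D$ on $\Gamma_3$, where $\Phi$ is the electric potential and $n$ is the outward unit normal. "Well-posed" has its usual meaning: a solution exists, is unique, and depends continuously on the data.
   Formalization: Besides being positive on the closed square, σ is assumed measurable and essentially bounded above and away from zero (automatic for continuous σ); for merely positive σ the form may be undefined or a solution may fail to exist. *)

theory Defs
  imports "HOL-Analysis.Analysis"
begin

text \<open>As usual in the library, elements are functions rather than equivalence classes: equality in
  \<open>L\<^sup>2\<close> and \<open>H\<^sup>1\<close> is equality almost everywhere.\<close>

definition L2 :: "'a measure \<Rightarrow> ('a \<Rightarrow> 'b::euclidean_space) set" where
  "L2 M = {f \<in> borel_measurable M. integrable M (\<lambda>x. (norm (f x))\<^sup>2)}"

definition L2_norm :: "'a measure \<Rightarrow> ('a \<Rightarrow> 'b::euclidean_space) \<Rightarrow> real" where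
  "L2_norm M f = sqrt (\<integral>x. (norm (f x))\<^sup>2 \<partial>M)"

primrec Ck :: "nat \<Rightarrow> ('a::euclidean_space \<Rightarrow> real) \<Rightarrow> bool" where
  "Ck 0 f \<longleftrightarrow> continuous_on UNIV f"
| "Ck (Suc k) f \<longleftrightarrow> (\<forall>x. f differentiable (at x)) \<and>
     (\<forall>i\<in>Basis. Ck k (\<lambda>x. frechet_derivative f (at x) i))"

definition smooth :: "('a::euclidean_space \<Rightarrow> real) \<Rightarrow> bool" where
  "smooth f \<longleftrightarrow> (\<forall>k. Ck k f)"

definition test_functions :: "'a::euclidean_space set \<Rightarrow> ('a \<Rightarrow> real) set" where
  "test_functions \<Omega> = {\<phi>. smooth \<phi> \<and> compact (closure {x. \<phi> x \<noteq> 0}) \<and> closure {x. \<phi> x \<noteq> 0} \<subseteq> \<Omega>}"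

definition has_weak_gradient ::
    "'a::euclidean_space set \<Rightarrow> ('a \<Rightarrow> real) \<Rightarrow> ('a \<Rightarrow> 'a) \<Rightarrow> bool" where
  "has_weak_gradient \<Omega> u g \<longleftrightarrow> (\<forall>\<phi>\<in>test_functions \<Omega>. \<forall>i\<in>Basis.
     (\<integral>x. u x * frechet_derivative \<phi> (at x) i \<partial>lebesgue_on \<Omega>) =
     - (\<integral>x. (g x \<bullet> i) * \<phi> x \<partial>lebesgue_on \<Omega>))"

definition H1 :: "'a::euclidean_space set \<Rightarrow> ('a \<Rightarrow> real) set" where
  "H1 \<Omega> = {u \<in> L2 (lebesgue_on \<Omega>). \<exists>g \<in> L2 (lebesgue_on \<Omega>). has_weak_gradient \<Omega> u g}"

text \<open>Determined up to a null set for \<open>u \<in> H1 \<Omega>\<close> and \<open>\<Omega>\<close> open; it is only used under integrals.\<close>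

definition weak_gradient :: "'a::euclidean_space set \<Rightarrow> ('a \<Rightarrow> real) \<Rightarrow> 'a \<Rightarrow> 'a" where
  "weak_gradient \<Omega> u = (SOME g. g \<in> L2 (lebesgue_on \<Omega>) \<and> has_weak_gradient \<Omega> u g)"

definition H1_norm :: "'a::euclidean_space set \<Rightarrow> ('a \<Rightarrow> real) \<Rightarrow> real" where
  "H1_norm \<Omega> u = sqrt ((L2_norm (lebesgue_on \<Omega>) u)\<^sup>2 +
                        (L2_norm (lebesgue_on \<Omega>) (weak_gradient \<Omega> u))\<^sup>2)"

text \<open>The trace operator is the continuous extension of the restriction map from functions smooth
  up to the boundary: \<open>g\<close> is the trace of \<open>u\<close> on the part of the boundary carrying the surface
  measure \<open>S\<close> iff \<open>(u, g)\<close> is the limit in \<open>H1 \<Omega> \<times> L2 S\<close> of pairs \<open>(\<phi>, \<phi>)\<close> with \<open>\<phi>\<close> smooth.\<close>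

definition has_trace ::
    "'a::euclidean_space set \<Rightarrow> 'a measure \<Rightarrow> ('a \<Rightarrow> real) \<Rightarrow> ('a \<Rightarrow> real) \<Rightarrow> bool" where
  "has_trace \<Omega> S u g \<longleftrightarrow> u \<in> H1 \<Omega> \<and> g \<in> L2 S \<and>
     (\<exists>\<phi>. (\<forall>n. smooth (\<phi> n) \<and> \<phi> n \<in> H1 \<Omega> \<inter> L2 S) \<and>
          (\<lambda>n::nat. H1_norm \<Omega> (\<lambda>x. \<phi> n x - u x)) \<longlonglongrightarrow> 0 \<and>
          (\<lambda>n. L2_norm S (\<lambda>x. \<phi> n x - g x)) \<longlonglongrightarrow> 0)"

definition trace :: "'a::euclidean_space set \<Rightarrow> 'a measure \<Rightarrow> ('a \<Rightarrow> real) \<Rightarrow> 'a \<Rightarrow> real" where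
  "trace \<Omega> S u = (SOME g. has_trace \<Omega> S u g)"

definition Omega :: "real \<Rightarrow> (real \<times> real) set" where
  "Omega L = {0<..<L} \<times> {0<..<L}"

definition Gamma1 :: "real \<Rightarrow> (real \<times> real) set" where
  "Gamma1 L = {z \<in> frontier (Omega L). fst z = 0}"

definition Gamma3 :: "real \<Rightarrow> (real \<times> real) set" where
  "Gamma3 L = {z \<in> frontier (Omega L). fst z = L}"

text \<open>Arc length on the vertical line through \<open>(c, 0)\<close>, parametrised by \<open>y \<mapsto> (c, y)\<close>.\<close>

definition arclength :: "real \<Rightarrow> (real \<times> real) measure" where
  "arclength c = distr lborel borel (\<lambda>y. (c, y))"

definition ds1 :: "real \<Rightarrow> (real \<times> real) measure" where
  "ds1 L = restrict_space (arclength 0) (Gamma1 L)"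

definition ds3 :: "real \<Rightarrow> (real \<times> real) measure" where
  "ds3 L = restrict_space (arclength L) (Gamma3 L)"

definition length1 :: "real \<Rightarrow> real" where
  "length1 L = measure (ds1 L) (Gamma1 L)"

lemma length1_eq:
  assumes "L > 0"
  shows "length1 L = L"
proof -
  have fr: "frontier (Omega L) = {0..L} \<times> {0..L} - {0<..<L} \<times> {0<..<L}"
    using assms by (simp add: Omega_def frontier_def closure_Times interior_Times)
  have G: "Gamma1 L = {0} \<times> {0..L}"
    using assms by (auto simp: Gamma1_def fr)
  have GB: "Gamma1 L \<in> sets borel"
    unfolding G by (intro borel_closed closed_Times) auto
  have "length1 L = measure (arclength 0) (Gamma1 L)"
    unfolding length1_def ds1_def using GB
    by (subst measure_restrict_space) (auto simp: arclength_def)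
  also have "\<dots> = measure lborel ((\<lambda>y. (0::real, y)) -` Gamma1 L)"
    unfolding arclength_def using GB by (subst measure_distr) auto
  also have "(\<lambda>y. (0::real, y)) -` Gamma1 L = {0..L}"
    by (auto simp: G)
  finally show ?thesis using assms by simp
qed

definition Vc :: "real \<Rightarrow> (real \<times> real \<Rightarrow> real) set" where
  "Vc L = {\<Phi> \<in> H1 (Omega L).
     (\<exists>c. has_trace (Omega L) (ds1 L) \<Phi> (\<lambda>_. c)) \<and> has_trace (Omega L) (ds3 L) \<Phi> (\<lambda>_. 0)}"

definition form_a :: "real \<Rightarrow> (real \<times> real \<Rightarrow> real) \<Rightarrow> real \<Rightarrow>
    (real \<times> real \<Rightarrow> real) \<Rightarrow> (real \<times> real \<Rightarrow> real) \<Rightarrow> real" where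
  "form_a L \<sigma> R \<Phi> v =
     (\<integral>z. \<sigma> z * (weak_gradient (Omega L) \<Phi> z \<bullet> weak_gradient (Omega L) v z) \<partial>lebesgue_on (Omega L)) +
     1 / (length1 L * R) *
       (\<integral>s. trace (Omega L) (ds1 L) \<Phi> s * trace (Omega L) (ds1 L) v s \<partial>ds1 L)"

definition form_L :: "real \<Rightarrow> real \<Rightarrow> (real \<times> real \<Rightarrow> real) \<Rightarrow> real \<Rightarrow>
    (real \<times> real \<Rightarrow> real) \<Rightarrow> real" where
  "form_L L R f U v =
     (\<integral>z. f z * v z \<partial>lebesgue_on (Omega L)) +
     U / (length1 L * R) * (\<integral>s. trace (Omega L) (ds1 L) v s \<partial>ds1 L)"

definition is_solution :: "real \<Rightarrow> (real \<times> real \<Rightarrow> real) \<Rightarrow> real \<Rightarrow>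
    (real \<times> real \<Rightarrow> real) \<Rightarrow> real \<Rightarrow> (real \<times> real \<Rightarrow> real) \<Rightarrow> bool" where
  "is_solution L \<sigma> R f U \<Phi> \<longleftrightarrow>
     \<Phi> \<in> Vc L \<and> (\<forall>v\<in>Vc L. form_a L \<sigma> R \<Phi> v = form_L L R f U v)"

text \<open>The data are the right-hand side \<open>(f, U) \<in> L\<^sup>2(\<Omega>) \<times> \<real>\<close>. The solution depends linearly on them, so
  continuous dependence is Lipschitz dependence with a constant independent of \<open>f\<close> and \<open>U\<close>.\<close>

definition well_posed :: "real \<Rightarrow> (real \<times> real \<Rightarrow> real) \<Rightarrow> real \<Rightarrow> bool" where
  "well_posed L \<sigma> R \<longleftrightarrow>
     (\<forall>f\<in>L2 (lebesgue_on (Omega L)). \<forall>U. \<exists>\<Phi>. is_solution L \<sigma> R f U \<Phi>) \<and>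
     (\<forall>f\<in>L2 (lebesgue_on (Omega L)). \<forall>U \<Phi> \<Phi>'.
        is_solution L \<sigma> R f U \<Phi> \<longrightarrow> is_solution L \<sigma> R f U \<Phi>' \<longrightarrow>
        (AE z in lebesgue_on (Omega L). \<Phi> z = \<Phi>' z)) \<and>
     (\<exists>C. \<forall>f\<in>L2 (lebesgue_on (Omega L)). \<forall>f'\<in>L2 (lebesgue_on (Omega L)). \<forall>U U' \<Phi> \<Phi>'.
        is_solution L \<sigma> R f U \<Phi> \<longrightarrow> is_solution L \<sigma> R f' U' \<Phi>' \<longrightarrow>
        H1_norm (Omega L) (\<lambda>z. \<Phi> z - \<Phi>' z)
          \<le> C * (L2_norm (lebesgue_on (Omega L)) (\<lambda>z. f z - f' z) + \<bar>U - U'\<bar>))"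

text \<open>Pointwise positivity alone does not make the form finite and coercive. The conductivity is
  moreover measurable and essentially bounded above and away from zero, which for a continuous
  function follows from positivity on the closed square.\<close>

definition positive_conductivity :: "real \<Rightarrow> (real \<times> real \<Rightarrow> real) \<Rightarrow> bool" where
  "positive_conductivity L \<sigma> \<longleftrightarrow>
     (\<forall>z\<in>closure (Omega L). 0 < \<sigma> z) \<and>
     \<sigma> \<in> borel_measurable (lebesgue_on (Omega L)) \<and>
     (\<exists>m M. 0 < m \<and> (AE z in lebesgue_on (Omega L). m \<le> \<sigma> z \<and> \<sigma> z \<le> M))"

lemma positive_conductivity_if_continuous:
  assumes "L > 0"
    and cont: "continuous_on (closure (Omega L)) \<sigma>"
    and pos: "\<And>z. z \<in> closure (Omega L) \<Longrightarrow> 0 < \<sigma> z"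
  shows "positive_conductivity L \<sigma>"
proof -
  have cl: "closure (Omega L) = {0..L} \<times> {0..L}"
    using assms by (simp add: Omega_def closure_Times)
  have comp: "compact (closure (Omega L))" and ne: "closure (Omega L) \<noteq> {}"
    unfolding cl using assms by (auto intro: compact_Times)
  obtain p where p: "p \<in> closure (Omega L)" "\<And>z. z \<in> closure (Omega L) \<Longrightarrow> \<sigma> p \<le> \<sigma> z"
    using continuous_attains_inf[OF comp ne cont] by blast
  obtain q where q: "\<And>z. z \<in> closure (Omega L) \<Longrightarrow> \<sigma> z \<le> \<sigma> q"
    using continuous_attains_sup[OF comp ne cont] by blast
  have sub: "Omega L \<subseteq> closure (Omega L)" by (rule closure_subset)
  have "open (Omega L)" by (simp add: Omega_def open_Times)
  then have meas: "\<sigma> \<in> borel_measurable (lebesgue_on (Omega L))"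
    by (intro continuous_imp_measurable_on_sets_lebesgue continuous_on_subset[OF cont sub]) auto
  have "AE z in lebesgue_on (Omega L). \<sigma> p \<le> \<sigma> z \<and> \<sigma> z \<le> \<sigma> q"
    using p q sub by (intro AE_I2) auto
  then show ?thesis
    unfolding positive_conductivity_def using pos p(1) meas by blast
qed

end

(*
The form is symmetric, bounded and coercive on V^c for the H1 norm, so the solution is the limit of a
minimising sequence of a(v, v) - 2 L(v), and coercivity gives uniqueness and the Lipschitz bound.

Coercivity and control of the boundary values come from one estimate. For smooth f and a fixed
abscissa c, integrating df/dx along horizontal lines bounds the L2 distance on the square between
f(x, y) and f(c, y) by L times the L2 norm of grad f. Passing to the limit along the sequences that define the
trace, this bounds u by its gradient if the trace on x = L vanishes, and the trace on x = 0 by the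
H1 norm. In particular traces are unique, and V^c is closed in H1, which is complete because L2 is.

The weak gradient is unique almost everywhere because products of one-dimensional cutoffs
exp (- 1 / t) converge boundedly to indicators of boxes, and boxes generate the Borel sets.
*)
theory Submission
  imports Defs "HOL-Computational_Algebra.Polynomial"
begin

text \<open>Functions stand for classes modulo null sets, and the weak gradient and the trace of a
  function are arbitrary choices. Identities for them, even linearity, are available only almost
  everywhere, through uniqueness. For the same reason the minimisation argument is stated for a bare
  set of functions with a form obeying linearity laws.

  The definition of a trace supplies smooth approximants, so an inequality for smooth functions
  reaches every element of V^c by a limit. The approximants need not satisfy the boundary conditions
  themselves: the smooth estimate keeps a boundary term, which disappears only in the limit.

  On x = 0 the trace of u is a constant c(u), so the boundary part of the form is c(u) c(v) / R, the
  length of the side cancelling. The constant is not prescribed, but it depends linearly and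
  continuously on u in H1, and this keeps V^c closed. Coercivity comes from the gradient part and
  the condition on x = L: the L2 norm of u is at most L times that of its gradient, whence the
  constant m / (1 + L^2).\<close>

text \<open>The common source of the Cauchy-Schwarz bounds below: in \<open>L2\<close>, for
  integrals over an interval, and for the abstract form. There it is also applied with
  \<open>A\<close> an energy gap instead of a squared norm.\<close>

lemma discriminant_nonpos:
  fixes A B C :: real
  assumes nn: "\<And>t. 0 \<le> A + 2 * t * B + t\<^sup>2 * C"
    and nnC: "0 \<le> C"
  shows "B\<^sup>2 \<le> A * C"
proof (cases "C = 0")
  case True
  have "B = 0"
  proof (rule ccontr)
    assume "B \<noteq> 0"
    \<comment> \<open>With \<open>C = 0\<close> the expression is affine in t and equals -1 at this
      t.\<close>
    with nn[of "- (A + 1) / (2 * B)"] True show False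
      by (simp add: field_simps)
  qed
  with True show ?thesis by simp
next
  case False
  with nnC have "C > 0" by simp
  \<comment> \<open>This t is the minimiser of the parabola, where its value is A - B^2 / C.\<close>
  with nn[of "- B / C"] show ?thesis by (simp add: field_simps power2_eq_square)
qed

section \<open>Square integrable functions\<close>

lemma L2_measurable: "f \<in> L2 M \<Longrightarrow> f \<in> borel_measurable M"
  by (simp add: L2_def)

lemma L2_integrable_square: "f \<in> L2 M \<Longrightarrow> integrable M (\<lambda>x. (norm (f x))\<^sup>2)"
  by (simp add: L2_def)

lemma L2_norm_nonneg [simp]: "0 \<le> L2_norm M f"
  by (simp add: L2_norm_def integral_nonneg_AE)

lemma L2_norm_square: "(L2_norm M f)\<^sup>2 = (\<integral>x. (norm (f x))\<^sup>2 \<partial>M)"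
  by (simp add: L2_norm_def integral_nonneg_AE)

lemma L2_norm_cong_AE:
  assumes "f \<in> borel_measurable M" "g \<in> borel_measurable M" "AE x in M. f x = g x"
  shows "L2_norm M f = L2_norm M g"
  unfolding L2_norm_def using assms by (intro arg_cong[of _ _ sqrt] integral_cong_AE) auto

lemma L2_scaleR:
  assumes "f \<in> L2 M"
  shows "(\<lambda>x. c *\<^sub>R f x) \<in> L2 M"
  using assms by (auto simp: L2_def power_mult_distrib)

lemma L2_add:
  assumes "f \<in> L2 M" "g \<in> L2 M"
  shows "(\<lambda>x. f x + g x) \<in> L2 M"
proof -
  have [measurable]: "f \<in> borel_measurable M" "g \<in> borel_measurable M"
    using assms by (auto simp: L2_def)
  have "integrable M (\<lambda>x. (norm (f x + g x))\<^sup>2)"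
  proof (rule Bochner_Integration.integrable_bound)
    show "integrable M (\<lambda>x. 2 * (norm (f x))\<^sup>2 + 2 * (norm (g x))\<^sup>2)"
      using assms by (auto simp: L2_def)
    show "AE x in M. norm ((norm (f x + g x))\<^sup>2) \<le> norm (2 * (norm (f x))\<^sup>2 + 2 * (norm (g x))\<^sup>2)"
    proof (rule AE_I2)
      fix x
      have "(norm (f x + g x))\<^sup>2 \<le> (norm (f x) + norm (g x))\<^sup>2"
        by (intro power_mono norm_triangle_ineq) auto
      also have "\<dots> \<le> 2 * (norm (f x))\<^sup>2 + 2 * (norm (g x))\<^sup>2"
        using sum_squares_bound[of "norm (f x)" "norm (g x)"] by (simp add: power2_sum)
      finally show "norm ((norm (f x + g x))\<^sup>2) \<le> norm (2 * (norm (f x))\<^sup>2 + 2 * (norm (g x))\<^sup>2)"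
        by simp
    qed
  qed auto
  then show ?thesis by (auto simp: L2_def)
qed

lemma L2_zero: "(\<lambda>x. 0) \<in> L2 M"
  by (simp add: L2_def)

lemma L2_lincomb:
  assumes "f \<in> L2 M" "g \<in> L2 M"
  shows "(\<lambda>x. f x + t *\<^sub>R g x) \<in> L2 M"
  using L2_add[OF assms(1) L2_scaleR[OF assms(2)]] .

lemma L2_diff:
  assumes "f \<in> L2 M" "g \<in> L2 M"
  shows "(\<lambda>x. f x - g x) \<in> L2 M"
  using L2_lincomb[OF assms, of "-1"] by simp

lemma L2_integrable_inner:
  assumes "f \<in> L2 M" "g \<in> L2 M"
  shows "integrable M (\<lambda>x. f x \<bullet> g x)"
proof (rule Bochner_Integration.integrable_bound)
  have [measurable]: "f \<in> borel_measurable M" "g \<in> borel_measurable M"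
    using assms by (auto simp: L2_def)
  show "integrable M (\<lambda>x. (norm (f x))\<^sup>2 + (norm (g x))\<^sup>2)"
    using assms by (auto simp: L2_def)
  show "AE x in M. norm (f x \<bullet> g x) \<le> norm ((norm (f x))\<^sup>2 + (norm (g x))\<^sup>2)"
  proof (rule AE_I2)
    fix x
    have "\<bar>f x \<bullet> g x\<bar> \<le> norm (f x) * norm (g x)" by (rule Cauchy_Schwarz_ineq2)
    also have "\<dots> \<le> (norm (f x))\<^sup>2 + (norm (g x))\<^sup>2"
      using sum_squares_bound[of "norm (f x)" "norm (g x)"]
        mult_nonneg_nonneg[OF norm_ge_zero norm_ge_zero, of "f x" "g x"] by linarith
    finally show "norm (f x \<bullet> g x) \<le> norm ((norm (f x))\<^sup>2 + (norm (g x))\<^sup>2)" by simp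
  qed
  show "(\<lambda>x. f x \<bullet> g x) \<in> borel_measurable M" by measurable
qed

lemma L2_integrable_mult:
  fixes f g :: "'a \<Rightarrow> real"
  assumes "f \<in> L2 M" "g \<in> L2 M"
  shows "integrable M (\<lambda>x. f x * g x)"
  using L2_integrable_inner[OF assms] by simp

lemma L2_norm_lincomb_square:
  assumes "f \<in> L2 M" "g \<in> L2 M"
  shows "(L2_norm M (\<lambda>x. f x + t *\<^sub>R g x))\<^sup>2
    = (L2_norm M f)\<^sup>2 + 2 * t * (\<integral>x. f x \<bullet> g x \<partial>M) + t\<^sup>2 * (L2_norm M g)\<^sup>2"
proof -
  have "(L2_norm M (\<lambda>x. f x + t *\<^sub>R g x))\<^sup>2
      = (\<integral>x. (norm (f x))\<^sup>2 + 2 * t * (f x \<bullet> g x) + t\<^sup>2 * (norm (g x))\<^sup>2 \<partial>M)"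
    unfolding L2_norm_square
  proof (intro Bochner_Integration.integral_cong refl)
    fix x
    show "(norm (f x + t *\<^sub>R g x))\<^sup>2 = (norm (f x))\<^sup>2 + 2 * t * (f x \<bullet> g x) + t\<^sup>2 * (norm (g x))\<^sup>2"
      unfolding power2_norm_eq_inner
      by (simp add: inner_add_left inner_add_right inner_commute[of "g x" "f x"] distrib_left power2_eq_square)
  qed
  also have "\<dots> = (L2_norm M f)\<^sup>2 + 2 * t * (\<integral>x. f x \<bullet> g x \<partial>M) + t\<^sup>2 * (L2_norm M g)\<^sup>2"
    unfolding L2_norm_square using assms by (simp add: L2_integrable_square L2_integrable_inner)
  finally show ?thesis .
qed

lemma L2_Cauchy_Schwarz:
  assumes "f \<in> L2 M" "g \<in> L2 M"
  shows "\<bar>\<integral>x. f x \<bullet> g x \<partial>M\<bar> \<le> L2_norm M f * L2_norm M g"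
proof -
  have "(\<integral>x. f x \<bullet> g x \<partial>M)\<^sup>2 \<le> (L2_norm M f)\<^sup>2 * (L2_norm M g)\<^sup>2"
  proof (rule discriminant_nonpos)
    fix t
    show "0 \<le> (L2_norm M f)\<^sup>2 + 2 * t * (\<integral>x. f x \<bullet> g x \<partial>M) + t\<^sup>2 * (L2_norm M g)\<^sup>2"
      unfolding L2_norm_lincomb_square[OF assms, symmetric] by simp
  qed simp
  then show ?thesis
    by (simp add: abs_le_square_iff[symmetric] power_mult_distrib[symmetric])
qed

lemma L2_Cauchy_Schwarz_mult:
  fixes f g :: "'a \<Rightarrow> real"
  assumes "f \<in> L2 M" "g \<in> L2 M"
  shows "\<bar>\<integral>x. f x * g x \<partial>M\<bar> \<le> L2_norm M f * L2_norm M g"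
  using L2_Cauchy_Schwarz[OF assms] by simp

lemma L2_norm_triangle:
  assumes "f \<in> L2 M" "g \<in> L2 M"
  shows "L2_norm M (\<lambda>x. f x + g x) \<le> L2_norm M f + L2_norm M g"
proof (rule power2_le_imp_le)
  have "(L2_norm M (\<lambda>x. f x + g x))\<^sup>2
      = (L2_norm M f)\<^sup>2 + 2 * (\<integral>x. f x \<bullet> g x \<partial>M) + (L2_norm M g)\<^sup>2"
    using L2_norm_lincomb_square[OF assms, of 1] by simp
  also have "\<dots> \<le> (L2_norm M f + L2_norm M g)\<^sup>2"
    using L2_Cauchy_Schwarz[OF assms] by (simp add: power2_sum)
  finally show "(L2_norm M (\<lambda>x. f x + g x))\<^sup>2 \<le> (L2_norm M f + L2_norm M g)\<^sup>2" .
qed auto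

lemma L2_norm_scaleR: "L2_norm M (\<lambda>x. c *\<^sub>R f x) = \<bar>c\<bar> * L2_norm M f"
  by (simp add: L2_norm_def power_mult_distrib real_sqrt_mult)

lemma L2_norm_minus_commute: "L2_norm M (\<lambda>x. f x - g x) = L2_norm M (\<lambda>x. g x - f x)"
  by (simp add: L2_norm_def norm_minus_commute)

lemma L2_norm_triangle_diff:
  assumes "f \<in> L2 M" "g \<in> L2 M" "h \<in> L2 M"
  shows "L2_norm M (\<lambda>x. f x - h x) \<le> L2_norm M (\<lambda>x. f x - g x) + L2_norm M (\<lambda>x. g x - h x)"
  using L2_norm_triangle[OF L2_diff[OF assms(1,2)] L2_diff[OF assms(2,3)]] by simp

lemma L2_norm_le_add_diff:
  assumes "f \<in> L2 M" "g \<in> L2 M"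
  shows "L2_norm M f \<le> L2_norm M g + L2_norm M (\<lambda>x. f x - g x)"
  using L2_norm_triangle[OF assms(2) L2_diff[OF assms]] by simp

lemma L2_norm_eq_0_imp_AE:
  assumes "f \<in> L2 M" "L2_norm M f = 0"
  shows "AE x in M. f x = 0"
proof -
  have "(\<integral>x. (norm (f x))\<^sup>2 \<partial>M) = 0"
    using assms(2) by (metis L2_norm_square zero_power2)
  then have "AE x in M. (norm (f x))\<^sup>2 = 0"
    using integral_nonneg_eq_0_iff_AE[OF L2_integrable_square[OF assms(1)]] by simp
  then show ?thesis by eventually_elim simp
qed

lemma L2_bounded_mult:
  assumes f: "f \<in> L2 M" and s: "s \<in> borel_measurable M" "AE x in M. \<bar>s x\<bar> \<le> B"
  shows "(\<lambda>x. s x *\<^sub>R f x) \<in> L2 M"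
proof -
  have [measurable]: "f \<in> borel_measurable M" using f by (rule L2_measurable)
  note [measurable] = s(1)
  have "integrable M (\<lambda>x. (norm (s x *\<^sub>R f x))\<^sup>2)"
  proof (rule Bochner_Integration.integrable_bound)
    show "integrable M (\<lambda>x. B\<^sup>2 * (norm (f x))\<^sup>2)"
      using f by (auto simp: L2_def)
    show "AE x in M. norm ((norm (s x *\<^sub>R f x))\<^sup>2) \<le> norm (B\<^sup>2 * (norm (f x))\<^sup>2)"
      using s(2)
    proof eventually_elim
      case (elim x)
      then have "\<bar>s x\<bar>\<^sup>2 \<le> B\<^sup>2" by (intro power_mono) auto
      then show ?case by (simp add: power_mult_distrib mult_right_mono)
    qed
  qed auto
  then show ?thesis by (simp add: L2_def)
qed

section \<open>Finite measures and completeness of L2\<close>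

lemma (in finite_measure) L2_integrable:
  assumes "f \<in> L2 M"
  shows "integrable M f"
proof (rule Bochner_Integration.integrable_bound)
  show "integrable M (\<lambda>x. (norm (f x))\<^sup>2 + 1)"
    using assms by (auto simp: L2_def)
  show "AE x in M. norm (f x) \<le> norm ((norm (f x))\<^sup>2 + 1)"
  proof (rule AE_I2)
    fix x
    have "norm (f x) \<le> (norm (f x))\<^sup>2 + 1"
      using sum_squares_bound[of "norm (f x)" 1] norm_ge_zero[of "f x"] by (simp del: norm_ge_zero)
    then show "norm (f x) \<le> norm ((norm (f x))\<^sup>2 + 1)" by simp
  qed
qed (use assms in \<open>auto simp: L2_def\<close>)

lemma (in finite_measure) L2_bounded:
  assumes "f \<in> borel_measurable M" "\<And>x. x \<in> space M \<Longrightarrow> norm (f x) \<le> B"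
  shows "f \<in> L2 M"
proof -
  have "integrable M (\<lambda>x. (norm (f x))\<^sup>2)"
  proof (rule integrable_const_bound[where B = "B\<^sup>2"])
    show "AE x in M. norm ((norm (f x))\<^sup>2) \<le> B\<^sup>2"
      by (intro AE_I2) (auto intro!: power_mono assms(2))
  qed (use assms in measurable)
  with assms show ?thesis by (simp add: L2_def)
qed

lemma (in finite_measure) L2_const: "(\<lambda>_. c) \<in> L2 M"
  by (rule L2_bounded[where B = "norm c"]) auto

text \<open>Cauchy-Schwarz against the constant 1. It makes \<open>L2\<close>-Cauchy sequences
  Cauchy in L1, where an almost everywhere convergent subsequence can be extracted.\<close>

lemma (in finite_measure) L1_le_L2:
  assumes "f \<in> L2 M"
  shows "(\<integral>x. norm (f x) \<partial>M) \<le> L2_norm M f * L2_norm M (\<lambda>_. 1::real)"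
proof -
  have "(\<lambda>x. norm (f x)) \<in> L2 M" using assms by (auto simp: L2_def)
  then have "\<bar>\<integral>x. norm (f x) * 1 \<partial>M\<bar> \<le> L2_norm M (\<lambda>x. norm (f x)) * L2_norm M (\<lambda>_. 1::real)"
    by (intro L2_Cauchy_Schwarz_mult) (auto intro: L2_const)
  then show ?thesis by (simp add: L2_norm_def)
qed

text \<open>Riesz-Fischer: the candidate limit comes from an almost everywhere convergent
  subsequence, and Fatou's lemma brings the convergence back to \<open>L2\<close>.\<close>

theorem (in finite_measure) L2_complete:
  fixes F :: "nat \<Rightarrow> 'a \<Rightarrow> 'b::euclidean_space"
  assumes F: "\<And>n. F n \<in> L2 M"
    and Cauchy: "\<And>e. 0 < e \<Longrightarrow> \<exists>N. \<forall>m\<ge>N. \<forall>n\<ge>N. L2_norm M (\<lambda>x. F m x - F n x) < e"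
  obtains f where "f \<in> L2 M" "(\<lambda>n. L2_norm M (\<lambda>x. F n x - f x)) \<longlonglongrightarrow> 0"
proof -
  note [measurable] = L2_measurable[OF F]
  \<comment> \<open>Adding 1 keeps the divisor positive even if the whole space has measure
    zero.\<close>
  let ?c = "L2_norm M (\<lambda>_. 1::real) + 1"
  have c: "?c > 0" by (simp add: add_nonneg_pos)
  have "\<exists>N. \<forall>i\<ge>N. \<forall>j\<ge>N. (\<integral>x. norm (F i x - F j x) \<partial>M) < e" if "e > 0" for e
  proof -
    obtain N where N: "\<And>m n. m \<ge> N \<Longrightarrow> n \<ge> N \<Longrightarrow> L2_norm M (\<lambda>x. F m x - F n x) < e / ?c"
      using Cauchy[of "e / ?c"] \<open>e > 0\<close> c by auto
    have "(\<integral>x. norm (F i x - F j x) \<partial>M) < e" if "i \<ge> N" "j \<ge> N" for i j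
    proof -
      have "(\<integral>x. norm (F i x - F j x) \<partial>M) \<le> L2_norm M (\<lambda>x. F i x - F j x) * L2_norm M (\<lambda>_. 1::real)"
        by (rule L1_le_L2[OF L2_diff[OF F F]])
      also have "\<dots> \<le> L2_norm M (\<lambda>x. F i x - F j x) * ?c"
        by (intro mult_left_mono) auto
      also have "\<dots> < e" using N[OF that] c by (simp add: field_simps)
      finally show ?thesis .
    qed
    then show ?thesis by blast
  qed
  then obtain r where r: "strict_mono r" "AE x in M. Cauchy (\<lambda>i. F (r i) x)"
    using cauchy_L1_AE_cauchy_subseq[of M F] L2_integrable[OF F] by blast
  \<comment> \<open>Off a null set \<open>lim\<close> is the true limit; elsewhere its value is
    unspecified, yet \<open>f\<close> stays measurable.\<close>
  define f where "f x = lim (\<lambda>i. F (r i) x)" for x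
  have f_meas [measurable]: "f \<in> borel_measurable M"
    unfolding f_def by (intro borel_measurable_lim_metric) auto
  have lim: "AE x in M. (\<lambda>i. F (r i) x) \<longlonglongrightarrow> f x"
    using r(2) by eventually_elim (simp add: f_def Cauchy_convergent_iff convergent_LIMSEQ_iff)
  \<comment> \<open>Fatou along the subsequence: the Cauchy bound on F m - F (r i) survives the
    limit in i, giving membership in \<open>L2\<close> and the rate together.\<close>
  have key: "(\<lambda>x. F m x - f x) \<in> L2 M \<and> L2_norm M (\<lambda>x. F m x - f x) \<le> e"
    if e: "e > 0" and m: "m \<ge> N" and N: "\<And>m n. m \<ge> N \<Longrightarrow> n \<ge> N \<Longrightarrow> L2_norm M (\<lambda>x. F m x - F n x) < e"
    for e m N
  proof -
    have "(\<integral>\<^sup>+x. ennreal ((norm (F m x - f x))\<^sup>2) \<partial>M)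
        = (\<integral>\<^sup>+x. liminf (\<lambda>i. ennreal ((norm (F m x - F (r i) x))\<^sup>2)) \<partial>M)"
    proof (intro nn_integral_cong_AE)
      show "AE x in M. ennreal ((norm (F m x - f x))\<^sup>2)
          = liminf (\<lambda>i. ennreal ((norm (F m x - F (r i) x))\<^sup>2))"
        using lim
      proof eventually_elim
        case (elim x)
        then have "(\<lambda>i. ennreal ((norm (F m x - F (r i) x))\<^sup>2)) \<longlonglongrightarrow> ennreal ((norm (F m x - f x))\<^sup>2)"
          by (intro tendsto_intros tendsto_ennrealI) auto
        then show ?case by (rule lim_imp_Liminf[OF sequentially_bot, symmetric])
      qed
    qed
    also have "\<dots> \<le> liminf (\<lambda>i. \<integral>\<^sup>+x. ennreal ((norm (F m x - F (r i) x))\<^sup>2) \<partial>M)"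
      by (intro nn_integral_liminf) measurable
    also have "\<dots> \<le> ennreal (e\<^sup>2)"
    proof (rule Liminf_le)
      show "\<forall>\<^sub>F i in sequentially. (\<integral>\<^sup>+x. ennreal ((norm (F m x - F (r i) x))\<^sup>2) \<partial>M) \<le> ennreal (e\<^sup>2)"
        using eventually_ge_at_top[of N]
      proof eventually_elim
        case (elim i)
        then have "r i \<ge> N" using seq_suble[OF r(1), of i] by simp
        then have "L2_norm M (\<lambda>x. F m x - F (r i) x) \<le> e" using N[OF m] by (simp add: less_imp_le)
        then have "(\<integral>x. (norm (F m x - F (r i) x))\<^sup>2 \<partial>M) \<le> e\<^sup>2"
          unfolding L2_norm_square[symmetric] by (intro power_mono) auto
        then show ?case
          by (subst nn_integral_eq_integral[OF L2_integrable_square[OF L2_diff[OF F F]]])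
             (auto intro: ennreal_leI)
      qed
    qed simp
    finally have le: "(\<integral>\<^sup>+x. ennreal ((norm (F m x - f x))\<^sup>2) \<partial>M) \<le> ennreal (e\<^sup>2)" .
    then have int: "integrable M (\<lambda>x. (norm (F m x - f x))\<^sup>2)"
      by (intro integrableI_nonneg) (auto simp: le_less_trans)
    have "(\<integral>x. (norm (F m x - f x))\<^sup>2 \<partial>M) \<le> e\<^sup>2"
      using le by (subst (asm) nn_integral_eq_integral[OF int]) (auto simp: ennreal_le_iff)
    then have "L2_norm M (\<lambda>x. F m x - f x) \<le> e"
      using e by (intro power2_le_imp_le[of "L2_norm M (\<lambda>x. F m x - f x)"]) (auto simp: L2_norm_square)
    with int show ?thesis by (auto simp: L2_def)
  qed
  obtain N1 where N1: "\<And>m n. m \<ge> N1 \<Longrightarrow> n \<ge> N1 \<Longrightarrow> L2_norm M (\<lambda>x. F m x - F n x) < 1"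
    using Cauchy[of 1] by auto
  have "(\<lambda>x. F N1 x - f x) \<in> L2 M" using key[of 1 N1 N1] N1 by simp
  \<comment> \<open>\<open>f\<close> is recovered as F N1 - (F N1 - f).\<close>
  from L2_diff[OF F[of N1] this] have "f \<in> L2 M" by simp
  moreover have "(\<lambda>n. L2_norm M (\<lambda>x. F n x - f x)) \<longlonglongrightarrow> 0"
  proof (rule LIMSEQ_I)
    fix e :: real assume "e > 0"
    then obtain N where N: "\<And>m n. m \<ge> N \<Longrightarrow> n \<ge> N \<Longrightarrow> L2_norm M (\<lambda>x. F m x - F n x) < e / 2"
      using Cauchy[of "e / 2"] by auto
    have "norm (L2_norm M (\<lambda>x. F n x - f x) - 0) < e" if "n \<ge> N" for n
      using key[OF _ that N] \<open>e > 0\<close> by fastforce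
    then show "\<exists>N. \<forall>n\<ge>N. norm (L2_norm M (\<lambda>x. F n x - f x) - 0) < e" by blast
  qed
  ultimately show ?thesis using that by blast
qed

section \<open>Representation of functionals by minimisation\<close>

text \<open>A minimising sequence of \<open>a v v - 2 * l v\<close> is Cauchy by the parallelogram law, and its limit
  represents \<open>l\<close>.\<close>

lemma symmetric_form_represents:
  fixes V :: "('x \<Rightarrow> real) set" and a :: "('x \<Rightarrow> real) \<Rightarrow> ('x \<Rightarrow> real) \<Rightarrow> real"
  assumes ne: "v0 \<in> V"
    and lin: "\<And>u v t. u \<in> V \<Longrightarrow> v \<in> V \<Longrightarrow> (\<lambda>x. u x + t * v x) \<in> V"
    and sym: "\<And>u v. u \<in> V \<Longrightarrow> v \<in> V \<Longrightarrow> a u v = a v u"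
    and a_lin: "\<And>u v w t. u \<in> V \<Longrightarrow> v \<in> V \<Longrightarrow> w \<in> V \<Longrightarrow> a (\<lambda>x. u x + t * v x) w = a u w + t * a v w"
    and pos: "\<And>u. u \<in> V \<Longrightarrow> 0 \<le> a u u"
    and l_lin: "\<And>u v t. u \<in> V \<Longrightarrow> v \<in> V \<Longrightarrow> l (\<lambda>x. u x + t * v x) = l u + t * l v"
    and bound: "\<And>v. v \<in> V \<Longrightarrow> \<bar>l v\<bar> \<le> C * sqrt (a v v)"
    and complete: "\<And>X. (\<And>n. X n \<in> V) \<Longrightarrow>
      (\<And>e. 0 < e \<Longrightarrow> \<exists>N. \<forall>m\<ge>N. \<forall>n\<ge>N. a (\<lambda>x. X m x - X n x) (\<lambda>x. X m x - X n x) < e) \<Longrightarrow>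
      \<exists>u\<in>V. (\<lambda>n. a (\<lambda>x. X n x - u x) (\<lambda>x. X n x - u x)) \<longlonglongrightarrow> 0"
  shows "\<exists>u\<in>V. \<forall>v\<in>V. a u v = l v"
proof -
  have a_lin2: "a w (\<lambda>x. u x + t * v x) = a w u + t * a w v" if "u \<in> V" "v \<in> V" "w \<in> V" for u v w t
    using that by (simp add: sym[OF \<open>w \<in> V\<close>] lin a_lin)
  have a_sq: "a (\<lambda>x. u x + t * v x) (\<lambda>x. u x + t * v x) = a u u + 2 * t * a u v + t\<^sup>2 * a v v"
    if "u \<in> V" "v \<in> V" for u v t
    using that by (simp add: a_lin a_lin2 lin sym[of v u] algebra_simps power2_eq_square)
  have a_diff: "a (\<lambda>x. u x - v x) (\<lambda>x. u x - v x) = a u u - 2 * a u v + a v v"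
    if "u \<in> V" "v \<in> V" for u v
    using a_sq[OF that, of "-1"] by simp
  define J where "J v = a v v - 2 * l v" for v
  \<comment> \<open>With s = sqrt (a v v) the bound on \<open>l\<close> gives J v \<ge> s^2 - 2 C s,
    and completing the square bounds this below by - C^2.\<close>
  have J_lower: "- C\<^sup>2 \<le> J v" if "v \<in> V" for v
  proof -
    have "0 \<le> (sqrt (a v v) - C)\<^sup>2" by simp
    then have "2 * C * sqrt (a v v) \<le> a v v + C\<^sup>2"
      using pos[OF that] by (simp add: power2_diff mult.commute mult.left_commute)
    with bound[OF that] show ?thesis by (simp add: J_def)
  qed
  define d where "d = Inf (J ` V)"
  have bdd: "bdd_below (J ` V)" using J_lower by (intro bdd_belowI2) auto
  have d_le: "d \<le> J v" if "v \<in> V" for v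
    unfolding d_def using bdd that by (intro cInf_lower) auto
  have "\<exists>v\<in>V. J v < d + 1 / Suc n" for n
  proof -
    have "d < d + 1 / Suc n" by simp
    then obtain y where "y \<in> J ` V" "y < d + 1 / Suc n"
      using cInf_lessD[of "J ` V" "d + 1 / Suc n"] ne unfolding d_def by blast
    then show ?thesis by blast
  qed
  then obtain X where X: "\<And>n. X n \<in> V" "\<And>n. J (X n) < d + 1 / Suc n" by metis
  have diffV: "(\<lambda>x. u x - v x) \<in> V" if "u \<in> V" "v \<in> V" for u v
    using lin[OF that, of "-1"] by simp
  \<comment> \<open>The midpoint of \<open>X m\<close> and \<open>X n\<close> lies in
    \<open>V\<close>, so its energy is at least \<open>d\<close>, while both ends are nearly
    minimal. The parallelogram identity turns this into a bound on their distance.\<close>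
  have parallelogram: "a (\<lambda>x. X m x - X n x) (\<lambda>x. X m x - X n x) \<le> 2 / Suc m + 2 / Suc n" for m n
  proof -
    have mid: "(\<lambda>x. X m x + (1/2) * (X n x - X m x)) \<in> V"
      using X by (intro lin diffV) auto
    have dV: "(\<lambda>x. X n x - X m x) \<in> V" using X by (intro diffV)
    have eq: "a (\<lambda>x. X n x - X m x) w = a (X n) w - a (X m) w" if "w \<in> V" for w
      using a_lin[OF X(1)[of n] X(1)[of m] that, of "-1"] by simp
    have dd: "a (\<lambda>x. X n x - X m x) (\<lambda>x. X n x - X m x) = a (X n) (X n) - 2 * a (X n) (X m) + a (X m) (X m)"
      by (rule a_diff[OF X(1) X(1)])
    have ll: "l (\<lambda>x. X n x - X m x) = l (X n) - l (X m)"
      using l_lin[OF X(1)[of n] X(1)[of m], of "-1"] by simp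
    have "J (\<lambda>x. X m x + (1/2) * (X n x - X m x)) =
      a (X m) (X m) + a (X m) (\<lambda>x. X n x - X m x) + a (\<lambda>x. X n x - X m x) (\<lambda>x. X n x - X m x) / 4
       - 2 * l (X m) - l (\<lambda>x. X n x - X m x)"
      unfolding J_def a_sq[OF X(1) dV] l_lin[OF X(1) dV] by (simp add: power2_eq_square)
    also have "a (X m) (\<lambda>x. X n x - X m x) = a (X n) (X m) - a (X m) (X m)"
      using sym[OF X(1) dV] eq[OF X(1)] by simp
    finally have Jmid: "J (\<lambda>x. X m x + (1/2) * (X n x - X m x)) = a (X n) (X m)
       + a (\<lambda>x. X n x - X m x) (\<lambda>x. X n x - X m x) / 4 - l (X m) - l (X n)"
      using ll by simp
    have "a (\<lambda>x. X n x - X m x) (\<lambda>x. X n x - X m x) = 2 * J (X m) + 2 * J (X n)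
       - 4 * J (\<lambda>x. X m x + (1/2) * (X n x - X m x))"
      unfolding Jmid dd J_def by (simp add: field_simps)
    also have "\<dots> \<le> 2 * J (X m) + 2 * J (X n) - 4 * d"
      using d_le[OF mid] by simp
    also have "\<dots> \<le> 2 / Suc m + 2 / Suc n" using X(2)[of m] X(2)[of n] by simp
    finally have "a (\<lambda>x. X n x - X m x) (\<lambda>x. X n x - X m x) \<le> 2 / Suc m + 2 / Suc n" .
    moreover have "a (\<lambda>x. X m x - X n x) (\<lambda>x. X m x - X n x) = a (\<lambda>x. X n x - X m x) (\<lambda>x. X n x - X m x)"
      unfolding dd a_diff[OF X(1) X(1), of m n] sym[OF X(1) X(1), of m n] by simp
    ultimately show ?thesis by simp
  qed
  have "\<exists>u\<in>V. (\<lambda>n. a (\<lambda>x. X n x - u x) (\<lambda>x. X n x - u x)) \<longlonglongrightarrow> 0"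
  proof (rule complete[OF X(1)])
    fix e :: real assume "e > 0"
    \<comment> \<open>Each of the terms 2 / Suc m and 2 / Suc n is then below e / 2.\<close>
    then obtain N where N: "inverse (real (Suc N)) < e / 4" using reals_Archimedean[of "e / 4"] by auto
    have "a (\<lambda>x. X m x - X n x) (\<lambda>x. X m x - X n x) < e" if "m \<ge> N" "n \<ge> N" for m n
    proof -
      have "1 / Suc m \<le> 1 / Suc N" "1 / Suc n \<le> 1 / Suc N" using that by (auto simp: divide_simps)
      then show ?thesis using parallelogram[of m n] N by (simp add: inverse_eq_divide)
    qed
    then show "\<exists>N. \<forall>m\<ge>N. \<forall>n\<ge>N. a (\<lambda>x. X m x - X n x) (\<lambda>x. X m x - X n x) < e" by blast
  qed
  then obtain u where u: "u \<in> V" "(\<lambda>n. a (\<lambda>x. X n x - u x) (\<lambda>x. X n x - u x)) \<longlonglongrightarrow> 0" by blast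
  have "a u v = l v" if v: "v \<in> V" for v
  proof -
    have inv: "(\<lambda>n. 1 / real (Suc n)) \<longlonglongrightarrow> 0"
      using LIMSEQ_inverse_real_of_nat by (simp add: inverse_eq_divide)
    \<comment> \<open>J (X n + t v) - d is nonnegative and \<open>X n\<close> is within 1 / Suc n of
      the infimum, so a quadratic in t is nonnegative. Its discriminant bounds the residual of
      \<open>X n\<close> in the equation tested with \<open>v\<close>.\<close>
    have 1: "(a (X n) v - l v)\<^sup>2 \<le> (1 / Suc n) * a v v" for n
    proof (rule discriminant_nonpos)
      fix t
      have "d \<le> J (\<lambda>x. X n x + t * v x)" using X v by (intro d_le lin)
      also have "\<dots> = J (X n) + 2 * t * (a (X n) v - l v) + t\<^sup>2 * a v v"
        unfolding J_def a_sq[OF X(1) v] l_lin[OF X(1) v] by (simp add: algebra_simps)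
      finally show "0 \<le> 1 / Suc n + 2 * t * (a (X n) v - l v) + t\<^sup>2 * a v v"
        using X(2)[of n] by simp
    qed (rule pos[OF v])
    \<comment> \<open>Cauchy-Schwarz for \<open>a\<close>, which is only assumed positive
      semidefinite.\<close>
    have 2: "(a (X n) v - a u v)\<^sup>2 \<le> a (\<lambda>x. X n x - u x) (\<lambda>x. X n x - u x) * a v v" for n
    proof -
      have "a (X n) v - a u v = a (\<lambda>x. X n x - u x) v"
        using a_lin[OF X(1) u(1) v, of _ "-1"] by simp
      also have "\<dots>\<^sup>2 \<le> a (\<lambda>x. X n x - u x) (\<lambda>x. X n x - u x) * a v v"
      proof (rule discriminant_nonpos)
        fix t
        have dV: "(\<lambda>x. X n x - u x) \<in> V" using X u by (intro diffV)
        show "0 \<le> a (\<lambda>x. X n x - u x) (\<lambda>x. X n x - u x) + 2 * t * a (\<lambda>x. X n x - u x) v + t\<^sup>2 * a v v"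
          unfolding a_sq[OF dV v, symmetric] by (intro pos lin dV v)
      qed (rule pos[OF v])
      finally show ?thesis .
    qed
    have null: "(\<lambda>n. f n) \<longlonglongrightarrow> c"
      if "\<And>n. (f n - c)\<^sup>2 \<le> g n * a v v" "g \<longlonglongrightarrow> 0" for f g :: "nat \<Rightarrow> real" and c
    proof -
      have "(\<lambda>n. (f n - c)\<^sup>2) \<longlonglongrightarrow> 0"
        by (rule Lim_null_comparison[OF _ tendsto_mult_left_zero[OF that(2), of "a v v"]]) (use that(1) in simp)
      then show ?thesis by (simp add: LIM_zero_iff)
    qed
    have "(\<lambda>n. a (X n) v) \<longlonglongrightarrow> l v" using 1 inv by (rule null)
    moreover have "(\<lambda>n. a (X n) v) \<longlonglongrightarrow> a u v" using 2 u(2) by (rule null)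
    ultimately show ?thesis by (metis LIMSEQ_unique)
  qed
  with u(1) show ?thesis by blast
qed

section \<open>Smooth functions\<close>

text \<open>The product rule multiplies a derivative of one factor by the other factor itself, so
  the induction for products needs the factors at the lower order too.\<close>

lemma Ck_Suc_imp_Ck: "Ck (Suc k) f \<Longrightarrow> Ck k f"
proof (induction k arbitrary: f)
  case 0
  then show ?case
    by (auto intro!: continuous_at_imp_continuous_on differentiable_imp_continuous_within)
qed auto

lemma Ck_const: "Ck k (\<lambda>x. c)"
  by (induction k arbitrary: c) auto

lemma frechet_derivative_mult:
  fixes f g :: "'a::euclidean_space \<Rightarrow> real"
  assumes "f differentiable (at x)" "g differentiable (at x)"
  shows "frechet_derivative (\<lambda>x. f x * g x) (at x) i
    = f x * frechet_derivative g (at x) i + frechet_derivative f (at x) i * g x"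
proof -
  have "((\<lambda>x. f x * g x) has_derivative
      (\<lambda>h. f x * frechet_derivative g (at x) h + frechet_derivative f (at x) h * g x)) (at x)"
    using assms by (intro has_derivative_mult frechet_derivative_works[THEN iffD1])
  from frechet_derivative_at[OF this] show ?thesis by metis
qed

lemma frechet_derivative_lincomb:
  fixes f g :: "'a::euclidean_space \<Rightarrow> real"
  assumes "f differentiable (at x)" "g differentiable (at x)"
  shows "frechet_derivative (\<lambda>x. f x + t * g x) (at x) i
    = frechet_derivative f (at x) i + t * frechet_derivative g (at x) i"
proof -
  have "((\<lambda>x. f x + t * g x) has_derivative
      (\<lambda>h. frechet_derivative f (at x) h + t * frechet_derivative g (at x) h)) (at x)"
    using assms by (intro has_derivative_add has_derivative_mult_right frechet_derivative_works[THEN iffD1])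
  from frechet_derivative_at[OF this] show ?thesis by metis
qed

lemma Ck_lincomb: "Ck k f \<Longrightarrow> Ck k g \<Longrightarrow> Ck k (\<lambda>x. f x + t * g x)"
proof (induction k arbitrary: f g)
  case 0
  then show ?case by (auto intro!: continuous_intros)
next
  case (Suc k)
  then show ?case
    by (auto simp: frechet_derivative_lincomb intro!: derivative_intros)
qed

lemma Ck_mult: "Ck k f \<Longrightarrow> Ck k g \<Longrightarrow> Ck k (\<lambda>x. f x * g x)"
proof (induction k arbitrary: f g)
  case 0
  then show ?case by (auto intro!: continuous_intros)
next
  case (Suc k)
  have "Ck k f" "Ck k g" using Suc.prems Ck_Suc_imp_Ck by blast+
  \<comment> \<open>The factor 1 gives the sum the shape f + t * g of
    \<open>Ck_lincomb\<close>.\<close>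
  then have "Ck k (\<lambda>x. f x * frechet_derivative g (at x) i + 1 * (frechet_derivative f (at x) i * g x))"
    if "i \<in> Basis" for i
    using Suc.prems that by (intro Ck_lincomb Suc.IH) auto
  with Suc.prems show ?case
    by (auto simp: frechet_derivative_mult intro!: derivative_intros)
qed

lemma smooth_lincomb: "smooth f \<Longrightarrow> smooth g \<Longrightarrow> smooth (\<lambda>x. f x + t * g x)"
  by (simp add: smooth_def Ck_lincomb)

lemma smooth_mult: "smooth f \<Longrightarrow> smooth g \<Longrightarrow> smooth (\<lambda>x. f x * g x)"
  by (simp add: smooth_def Ck_mult)

lemma smooth_const: "smooth (\<lambda>x. c)"
  by (simp add: smooth_def Ck_const)

lemma smooth_prod: "(\<And>i. i \<in> I \<Longrightarrow> smooth (f i)) \<Longrightarrow> smooth (\<lambda>x. \<Prod>i\<in>I. f i x)"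
  by (induction I rule: infinite_finite_induct) (auto intro: smooth_const smooth_mult)

lemma smooth_differentiable:
  assumes "smooth f"
  shows "f differentiable (at x)"
proof -
  have "Ck (Suc 0) f" using assms unfolding smooth_def by blast
  then show ?thesis by simp
qed

lemma smooth_has_derivative: "smooth f \<Longrightarrow> (f has_derivative frechet_derivative f (at x)) (at x)"
  by (intro frechet_derivative_works[THEN iffD1] smooth_differentiable)

lemma smooth_continuous: "smooth f \<Longrightarrow> continuous_on A f"
  by (metis Ck.simps(1) continuous_on_subset smooth_def subset_UNIV)

lemma smooth_continuous_derivative:
  assumes "smooth f" "i \<in> Basis"
  shows "continuous_on A (\<lambda>x. frechet_derivative f (at x) i)"
proof -
  have "Ck (Suc 0) f" using assms unfolding smooth_def by blast
  with assms(2) show ?thesis by (auto intro: continuous_on_subset)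
qed

section \<open>Smooth cutoffs of boxes\<close>

text \<open>A whole sequence of successive derivatives is carried along, so that differentiating
  merely raises the index and contributes a constant factor; the induction on \<open>k\<close> then
  closes for arbitrary \<open>i\<close>.\<close>

lemma Ck_compose_inner:
  fixes D :: "nat \<Rightarrow> real \<Rightarrow> real" and e :: "'a::euclidean_space"
  assumes D: "\<And>i t. (D i has_real_derivative D (Suc i) t) (at t)"
  shows "Ck k (\<lambda>x. D i (c * (x \<bullet> e) + d))"
proof (induction k arbitrary: i)
  case 0
  have "continuous_on UNIV (D i)"
    by (intro continuous_at_imp_continuous_on ballI DERIV_isCont[OF D])
  then show ?case
    by (auto intro!: continuous_on_compose2[of UNIV "D i"] continuous_intros)
next
  case (Suc k)
  have der: "((\<lambda>x. D i (c * (x \<bullet> e) + d)) has_derivative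
      (\<lambda>h. D (Suc i) (c * (x \<bullet> e) + d) * (c * (h \<bullet> e)))) (at x)" for x
  proof -
    have "((\<lambda>x. c * (x \<bullet> e) + d) has_derivative (\<lambda>h. c * (h \<bullet> e))) (at x)"
      by (auto intro!: derivative_eq_intros)
    from has_derivative_compose[OF this D[unfolded has_field_derivative_def]] show ?thesis .
  qed
  have eq: "frechet_derivative (\<lambda>x. D i (c * (x \<bullet> e) + d)) (at x) h
      = D (Suc i) (c * (x \<bullet> e) + d) * (c * (h \<bullet> e))" for x h
    using frechet_derivative_at[OF der] by metis
  have "(\<lambda>x. D i (c * (x \<bullet> e) + d)) differentiable (at x)" for x
    using der unfolding differentiable_def by blast
  then show ?case
    unfolding Ck.simps eq by (intro conjI allI ballI Ck_mult Ck_const Suc.IH)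
qed

text \<open>The derivatives of \<open>exp (- 1 / t)\<close>, extended by zero to \<open>t \<le> 0\<close>, are all of this form.\<close>

definition flat_exp :: "real poly \<Rightarrow> real \<Rightarrow> real" where
  "flat_exp p t = (if t > 0 then poly p (1 / t) * exp (- (1 / t)) else 0)"

lemma poly_times_exp_tendsto_0: "((\<lambda>x::real. poly p x * exp (- x)) \<longlongrightarrow> 0) at_top"
proof -
  have "((\<lambda>x::real. \<Sum>i\<le>degree p. coeff p i * (x ^ i / exp x)) \<longlongrightarrow> (\<Sum>i\<le>degree p. coeff p i * 0)) at_top"
    by (intro tendsto_intros tendsto_power_div_exp_0)
  then show ?thesis
    by (simp add: poly_altdef sum_distrib_right exp_minus divide_inverse mult.assoc)
qed

lemma flat_exp_tendsto_0: "(flat_exp p \<longlongrightarrow> 0) (at_right 0)"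
proof -
  have "((\<lambda>t. poly p (1 / t) * exp (- (1 / t))) \<longlongrightarrow> 0) (at_right 0)"
    using filterlim_compose[OF poly_times_exp_tendsto_0 filterlim_inverse_at_top_right]
    by (simp add: inverse_eq_divide)
  moreover have "\<forall>\<^sub>F t in at_right 0. flat_exp p t = poly p (1 / t) * exp (- (1 / t))"
    using eventually_at_right_less[of 0] by eventually_elim (simp add: flat_exp_def)
  ultimately show ?thesis by (simp add: tendsto_cong)
qed

text \<open>With s = 1 / t, differentiating p(s) exp(-s) in t gives s^2 (p(s) - p'(s)) exp(-s). The
  two \<open>pCons 0\<close> are the multiplication by s^2.\<close>

lemma flat_exp_has_derivative:
  "(flat_exp p has_real_derivative flat_exp (pCons 0 (pCons 0 (p - pderiv p))) t) (at t)"
proof -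
  consider "t > 0" | "t < 0" | "t = 0" by linarith
  then show ?thesis
  proof cases
    case 1
    have "((\<lambda>t. poly p (1 / t) * exp (- (1 / t))) has_real_derivative
        flat_exp (pCons 0 (pCons 0 (p - pderiv p))) t) (at t)"
      using 1 by (auto intro!: derivative_eq_intros DERIV_chain'[OF _ poly_DERIV]
          simp: flat_exp_def field_simps power2_eq_square)
    then show ?thesis
      by (rule has_field_derivative_transform_within_open[where S = "{0<..}"])
         (use 1 in \<open>auto simp: flat_exp_def\<close>)
  next
    case 2
    have "((\<lambda>t. 0) has_real_derivative flat_exp (pCons 0 (pCons 0 (p - pderiv p))) t) (at t)"
      using 2 by (auto simp: flat_exp_def)
    then show ?thesis
      by (rule has_field_derivative_transform_within_open[where S = "{..<0}"])
         (use 2 in \<open>auto simp: flat_exp_def\<close>)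
  next
    case 3
    \<comment> \<open>Dividing by h multiplies the polynomial by its variable 1 / h, so the
      difference quotient at 0 is again a \<open>flat_exp\<close> to the right of 0.\<close>
    have r: "((\<lambda>h. flat_exp p h / h) \<longlongrightarrow> 0) (at_right 0)"
    proof -
      have "\<forall>\<^sub>F h in at_right 0. flat_exp (pCons 0 p) h = flat_exp p h / h"
        using eventually_at_right_less[of 0] by eventually_elim (simp add: flat_exp_def)
      with flat_exp_tendsto_0[of "pCons 0 p"] show ?thesis by (simp add: tendsto_cong)
    qed
    have l: "((\<lambda>h. flat_exp p h / h) \<longlongrightarrow> 0) (at_left 0)"
    proof -
      have "\<forall>\<^sub>F h in at_left 0. 0 = flat_exp p h / h"
        unfolding eventually_at_filter by (intro always_eventually) (auto simp: flat_exp_def)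
      then show ?thesis by (rule Lim_transform_eventually[OF tendsto_const])
    qed
    show ?thesis
      using filterlim_split_at[OF l r] 3 by (simp add: has_field_derivative_iff flat_exp_def)
  qed
qed

lemma smooth_flat_exp_inner:
  fixes e :: "'a::euclidean_space"
  shows "smooth (\<lambda>x. flat_exp 1 (c * (x \<bullet> e) + d))"
proof -
  define D where "D i = flat_exp (((\<lambda>p. pCons 0 (pCons 0 (p - pderiv p))) ^^ i) 1)" for i
  have "Ck k (\<lambda>x. D 0 (c * (x \<bullet> e) + d))" for k
    by (rule Ck_compose_inner) (simp add: D_def flat_exp_has_derivative)
  then show ?thesis by (simp add: D_def smooth_def)
qed

lemma flat_exp_1_bounds: "0 \<le> flat_exp 1 t" "flat_exp 1 t \<le> 1"
  by (auto simp: flat_exp_def)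

lemma flat_exp_1_tendsto_1: "(flat_exp 1 \<longlongrightarrow> 1) at_top"
proof -
  have "((\<lambda>t::real. exp (- inverse t)) \<longlongrightarrow> exp (- 0)) at_top"
    by (intro tendsto_intros tendsto_inverse_0_at_top filterlim_ident)
  moreover have "\<forall>\<^sub>F t in at_top. exp (- inverse t) = flat_exp 1 t"
    using eventually_gt_at_top[of 0] by eventually_elim (simp add: flat_exp_def inverse_eq_divide)
  ultimately show ?thesis by (auto intro: Lim_transform_eventually)
qed

text \<open>Subtracting 1 keeps the support of the \<open>n\<close>-th cutoff at distance \<open>1 / Suc n\<close> from the
  complement of the box.\<close>

definition box_cutoff :: "'a::euclidean_space \<Rightarrow> 'a \<Rightarrow> nat \<Rightarrow> 'a \<Rightarrow> real" where
  "box_cutoff a b n x = (\<Prod>i\<in>Basis.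
     flat_exp 1 (Suc n * (x \<bullet> i) + (- Suc n * (a \<bullet> i) - 1)) *
     flat_exp 1 (- Suc n * (x \<bullet> i) + (Suc n * (b \<bullet> i) - 1)))"

lemma box_cutoff_bounds: "0 \<le> box_cutoff a b n x" "box_cutoff a b n x \<le> 1"
  unfolding box_cutoff_def
  by (auto intro!: prod_nonneg prod_le_1 mult_nonneg_nonneg mult_le_one flat_exp_1_bounds)

lemma flat_exp_1_pos_iff: "flat_exp 1 t \<noteq> 0 \<longleftrightarrow> 0 < t"
  by (simp add: flat_exp_def)

lemma box_cutoff_support:
  "{x. box_cutoff a b n x \<noteq> 0} \<subseteq> cbox (a + (1 / Suc n) *\<^sub>R One) (b - (1 / Suc n) *\<^sub>R One)"
proof
  fix x assume "x \<in> {x. box_cutoff a b n x \<noteq> 0}"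
  then have "0 < Suc n * (x \<bullet> i) + (- Suc n * (a \<bullet> i) - 1) \<and>
      0 < - Suc n * (x \<bullet> i) + (Suc n * (b \<bullet> i) - 1)" if "i \<in> Basis" for i
    using that by (auto simp: box_cutoff_def flat_exp_1_pos_iff simp del: of_nat_Suc)
  then have "1 / Suc n \<le> x \<bullet> i - a \<bullet> i \<and> 1 / Suc n \<le> b \<bullet> i - x \<bullet> i" if "i \<in> Basis" for i
    using that by (simp add: divide_le_eq right_diff_distrib mult.commute less_imp_le del: of_nat_Suc) force
  then show "x \<in> cbox (a + (1 / Suc n) *\<^sub>R One) (b - (1 / Suc n) *\<^sub>R One)"
    by (force simp: mem_box inner_add_left inner_diff_left simp del: of_nat_Suc)
qed

lemma box_cutoff_test_function: "box_cutoff a b n \<in> test_functions (box a b)"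
proof -
  have "smooth (box_cutoff a b n)"
    unfolding box_cutoff_def[abs_def] by (intro smooth_prod smooth_mult smooth_flat_exp_inner)
  moreover have sub: "closure {x. box_cutoff a b n x \<noteq> 0}
      \<subseteq> cbox (a + (1 / Suc n) *\<^sub>R One) (b - (1 / Suc n) *\<^sub>R One)"
    by (intro closure_minimal box_cutoff_support closed_cbox)
  moreover from sub have "compact (closure {x. box_cutoff a b n x \<noteq> 0})"
    by (metis closed_closure compact_cbox compact_Int_closed inf.absorb_iff2)
  moreover have "cbox (a + (1 / Suc n) *\<^sub>R One) (b - (1 / Suc n) *\<^sub>R One) \<subseteq> box a b"
  proof
    fix x assume x: "x \<in> cbox (a + (1 / Suc n) *\<^sub>R One) (b - (1 / Suc n) *\<^sub>R One)"
    have "a \<bullet> i < x \<bullet> i \<and> x \<bullet> i < b \<bullet> i" if i: "i \<in> Basis" for i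
    proof -
      have "a \<bullet> i + 1 / Suc n \<le> x \<bullet> i" "x \<bullet> i \<le> b \<bullet> i - 1 / Suc n"
        using x i by (auto simp: mem_box inner_add_left inner_diff_left simp del: of_nat_Suc)
      moreover have "0 < 1 / real (Suc n)" by simp
      ultimately show ?thesis by linarith
    qed
    then show "x \<in> box a b" by (simp add: mem_box)
  qed
  ultimately show ?thesis unfolding test_functions_def by blast
qed

lemma box_cutoff_tendsto: "(\<lambda>n. box_cutoff a b n x) \<longlonglongrightarrow> indicator (box a b) x"
proof (cases "x \<in> box a b")
  case True
  \<comment> \<open>Each factor of the cutoff is \<open>flat_exp 1\<close> at (n + 1) s - 1, where s
    is the distance from \<open>x\<close> to a face of the box.\<close>
  have lim: "(\<lambda>n. flat_exp 1 (Suc n * s - 1)) \<longlonglongrightarrow> 1" if "s > 0" for s :: real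
  proof -
    have "filterlim (\<lambda>n. - 1 + s * real (Suc n)) at_top sequentially"
      using that
      by (intro filterlim_tendsto_add_at_top[OF tendsto_const]
          filterlim_tendsto_pos_mult_at_top[OF tendsto_const]
          filterlim_compose[OF filterlim_real_sequentially filterlim_Suc])
    then show ?thesis
      by (intro filterlim_compose[OF flat_exp_1_tendsto_1]) (simp add: algebra_simps)
  qed
  have "(\<lambda>n. box_cutoff a b n x) \<longlonglongrightarrow> (\<Prod>i\<in>(Basis::'a set). 1 * 1)"
    unfolding box_cutoff_def
  proof (intro tendsto_intros)
    fix i :: 'a assume i: "i \<in> Basis"
    show "(\<lambda>n. flat_exp 1 (Suc n * (x \<bullet> i) + (- Suc n * (a \<bullet> i) - 1))) \<longlonglongrightarrow> 1"
      using lim[of "x \<bullet> i - a \<bullet> i"] True i by (simp add: mem_box algebra_simps)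
    show "(\<lambda>n. flat_exp 1 (- Suc n * (x \<bullet> i) + (Suc n * (b \<bullet> i) - 1))) \<longlonglongrightarrow> 1"
      using lim[of "b \<bullet> i - x \<bullet> i"] True i by (simp add: mem_box algebra_simps)
  qed
  with True show ?thesis by simp
next
  case False
  have "box_cutoff a b n x = 0" for n
    using box_cutoff_test_function[of a b n] closure_subset[of "{x. box_cutoff a b n x \<noteq> 0}"] False
    unfolding test_functions_def by blast
  with False show ?thesis by simp
qed

section \<open>Weak gradients\<close>

lemma finite_measure_lebesgue_on_box: "finite_measure (lebesgue_on (box a b))"
  by (simp add: finite_measure_lebesgue_on)

lemma test_functions_mono: "A \<subseteq> B \<Longrightarrow> test_functions A \<subseteq> test_functions B"
  by (auto simp: test_functions_def)

section \<open>The fundamental lemma of the calculus of variations\<close>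

text \<open>\<open>box a b\<close> may stick out of the domain. Its intersection with the domain is
  again a box, whose cutoffs are admissible test functions; dominated convergence with bound |g|
  does the rest.\<close>

lemma integral_box_eq_0_if_orthogonal_to_test_functions:
  fixes g :: "'a::euclidean_space \<Rightarrow> real"
  assumes g: "integrable (lebesgue_on (box c d)) g"
    and orth: "\<And>\<psi>. \<psi> \<in> test_functions (box c d) \<Longrightarrow> (\<integral>x. g x * \<psi> x \<partial>lebesgue_on (box c d)) = 0"
  shows "(\<integral>x. indicator (box a b) x * g x \<partial>lebesgue_on (box c d)) = 0"
proof -
  let ?M = "lebesgue_on (box c d)"
  note [measurable] = borel_measurable_integrable[OF g]
  obtain a' b' where ab: "box a b \<inter> box c d = box a' b'"
    unfolding box_Int_box by blast
  have meas [measurable]: "box_cutoff a' b' n \<in> borel_measurable ?M" for n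
    using smooth_continuous[of "box_cutoff a' b' n"] box_cutoff_test_function[of a' b' n]
    unfolding test_functions_def
    by (intro continuous_imp_measurable_on_sets_lebesgue) auto
  have "(\<lambda>n. \<integral>x. g x * box_cutoff a' b' n x \<partial>?M) \<longlonglongrightarrow> (\<integral>x. g x * indicator (box a' b') x \<partial>?M)"
  proof (rule integral_dominated_convergence)
    show "integrable ?M (\<lambda>x. norm (g x))" using g by simp
    show "AE x in ?M. (\<lambda>n. g x * box_cutoff a' b' n x) \<longlonglongrightarrow> g x * indicator (box a' b') x"
      by (intro AE_I2 tendsto_mult tendsto_const box_cutoff_tendsto)
    show "AE x in ?M. norm (g x * box_cutoff a' b' n x) \<le> norm (g x)" for n
      by (intro AE_I2) (simp add: abs_mult box_cutoff_bounds mult_left_le)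
    show "(\<lambda>x. g x * indicator (box a' b') x) \<in> borel_measurable ?M"
      by (intro borel_measurable_times borel_measurable_indicator')
         (auto simp: sets_restrict_space_iff borel_measurable_integrable[OF g] intro!: measurable_restrict_space1)
  qed simp
  moreover have "(\<integral>x. g x * box_cutoff a' b' n x \<partial>?M) = 0" for n
    using test_functions_mono[of "box a' b'" "box c d"] box_cutoff_test_function[of a' b' n] ab
    by (intro orth) blast
  ultimately have "(\<integral>x. g x * indicator (box a' b') x \<partial>?M) = 0"
    by (simp add: LIMSEQ_const_iff)
  moreover have "(\<integral>x. indicator (box a b) x * g x \<partial>?M) = (\<integral>x. g x * indicator (box a' b') x \<partial>?M)"
    by (intro Bochner_Integration.integral_cong refl) (auto simp: ab[symmetric] indicator_def)
  ultimately show ?thesis by simp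
qed

text \<open>The Borel sets over which \<open>g\<close> integrates to zero form a Dynkin system
  containing the boxes, an intersection-stable generator. A function whose integral over every
  measurable set is zero vanishes almost everywhere.\<close>

lemma AE_0_if_orthogonal_to_test_functions:
  fixes g :: "'a::euclidean_space \<Rightarrow> real"
  assumes g: "integrable (lebesgue_on (box c d)) g"
    and orth: "\<And>\<psi>. \<psi> \<in> test_functions (box c d) \<Longrightarrow> (\<integral>x. g x * \<psi> x \<partial>lebesgue_on (box c d)) = 0"
  shows "AE x in lebesgue_on (box c d). g x = 0"
proof -
  let ?M = "lebesgue_on (box c d)"
  interpret finite_measure ?M by (rule finite_measure_lebesgue_on_box)
  note [measurable] = borel_measurable_integrable[OF g]
  note box0 = integral_box_eq_0_if_orthogonal_to_test_functions[OF g orth]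
  have ind_meas: "indicator B \<in> borel_measurable ?M" if "B \<in> sets borel" for B :: "'a set"
    using that by (intro measurable_restrict_space1 borel_measurable_indicator) auto
  have ind_int: "integrable ?M (\<lambda>x. indicator B x * g x)" if "B \<in> sets borel" for B
  proof (rule Bochner_Integration.integrable_bound[OF g])
    show "(\<lambda>x. indicator B x * g x) \<in> borel_measurable ?M"
      using ind_meas[OF that] by measurable
  qed (auto simp: indicator_def)
  have borel0: "(\<integral>x. indicator B x * g x \<partial>?M) = 0" if "B \<in> sets borel" for B
  proof -
    have "Int_stable (range (\<lambda>(a, b). box a b :: 'a set))"
      by (auto simp: Int_stable_def box_Int_box)
    moreover have "range (\<lambda>(a, b). box a b) \<subseteq> Pow (UNIV :: 'a set)" by auto
    moreover have "B \<in> sigma_sets UNIV (range (\<lambda>(a, b). box a b))"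
      using that by (simp add: borel_eq_box)
    ultimately show ?thesis
    proof (induction rule: sigma_sets_induct_disjoint)
      case (basic A)
      then show ?case using box0 by auto
    next
      case empty
      then show ?case by simp
    next
      case (compl A)
      then have "A \<in> sets borel" by (simp add: borel_eq_box)
      \<comment> \<open>The domain is itself a box, so the integral of \<open>g\<close> over the
        whole space is zero; this gives closure under complements.\<close>
      have "(\<integral>x. g x \<partial>?M) = (\<integral>x. indicator (box c d) x * g x \<partial>?M)"
        by (intro Bochner_Integration.integral_cong) auto
      also have "\<dots> = 0" by (rule box0)
      finally have "(\<integral>x. g x \<partial>?M) = 0" .
      moreover have "(\<integral>x. indicator (UNIV - A) x * g x \<partial>?M) = (\<integral>x. g x - indicator A x * g x \<partial>?M)"
        by (intro Bochner_Integration.integral_cong refl) (auto simp: indicator_def)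
      ultimately show ?case
        using compl ind_int[OF \<open>A \<in> sets borel\<close>] g by simp
    next
      case (union A)
      then have A: "A i \<in> sets borel" for i by (auto simp: borel_eq_box)
      \<comment> \<open>Disjointness splits the integral over a finite partial union into a sum of
        zeros; dominated convergence passes to the full union.\<close>
      have "(\<lambda>n. \<integral>x. indicator (\<Union>i<n. A i) x * g x \<partial>?M) \<longlonglongrightarrow> (\<integral>x. indicator (\<Union>i. A i) x * g x \<partial>?M)"
      proof (rule integral_dominated_convergence)
        show "integrable ?M (\<lambda>x. norm (g x))" using g by simp
        show "AE x in ?M. (\<lambda>n. indicator (\<Union>i<n. A i) x * g x) \<longlonglongrightarrow> indicator (\<Union>i. A i) x * g x"
          by (intro AE_I2 tendsto_mult tendsto_const LIMSEQ_indicator_UN)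
        show "AE x in ?M. norm (indicator (\<Union>i<n. A i) x * g x) \<le> norm (g x)" for n
          by (auto simp: indicator_def)
      qed (use A in \<open>auto intro!: borel_measurable_times ind_meas\<close>)
      moreover have "(\<integral>x. indicator (\<Union>i<n. A i) x * g x \<partial>?M) = 0" for n
      proof -
        have "(\<integral>x. indicator (\<Union>i<n. A i) x * g x \<partial>?M) = (\<integral>x. (\<Sum>i<n. indicator (A i) x * g x) \<partial>?M)"
          using union(1) by (intro Bochner_Integration.integral_cong refl)
            (simp add: indicator_UN_disjoint disjoint_family_on_mono[of "{..<n}" UNIV] sum_distrib_right)
        also have "\<dots> = (\<Sum>i<n. \<integral>x. indicator (A i) x * g x \<partial>?M)"
          by (intro Bochner_Integration.integral_sum ind_int A)
        finally show ?thesis using union by simp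
      qed
      ultimately show ?case by (simp add: LIMSEQ_const_iff)
    qed
  qed
  show ?thesis
  proof (rule density_zero[OF g])
    fix A assume "A \<in> sets ?M"
    then have A: "A \<in> sets lebesgue" by (auto simp: sets_restrict_space)
    \<comment> \<open>A Lebesgue set is a Borel set up to a subset of a Borel null set, so the Borel
      case decides.\<close>
    then obtain S N N' where S: "A = S \<union> N" "N \<subseteq> N'" "N' \<in> null_sets lborel" "S \<in> sets lborel"
      by (auto elim: completionE sets_completionE)
    have "AE x in lebesgue. x \<notin> N'"
      using S(3) by (intro AE_not_in null_sets_completionI)
    then have N': "AE x in ?M. x \<notin> N'" by (subst AE_restrict_space_iff) (auto elim!: eventually_mono)
    have "set_lebesgue_integral ?M A g = (\<integral>x. indicator S x * g x \<partial>?M)"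
      unfolding set_lebesgue_integral_def
    proof (intro integral_cong_AE)
      show "AE x in ?M. indicator A x *\<^sub>R g x = indicator S x * g x"
        using N' by eventually_elim (use S in \<open>auto simp: indicator_def\<close>)
      show "(\<lambda>x. indicator A x *\<^sub>R g x) \<in> borel_measurable ?M"
        using \<open>A \<in> sets ?M\<close> by measurable
      show "(\<lambda>x. indicator S x * g x) \<in> borel_measurable ?M"
        using S(4) by (intro borel_measurable_integrable ind_int) simp
    qed
    also have "\<dots> = 0" using S(4) by (intro borel0) simp
    finally show "set_lebesgue_integral ?M A g = 0" .
  qed
qed

lemma continuous_L2_box:
  fixes f :: "'a::euclidean_space \<Rightarrow> 'b::euclidean_space"
  assumes "continuous_on (cbox a b) f"
  shows "f \<in> L2 (lebesgue_on (box a b))"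
proof -
  interpret finite_measure "lebesgue_on (box a b)" by (rule finite_measure_lebesgue_on_box)
  have "bounded (f ` cbox a b)"
    using assms by (intro compact_imp_bounded compact_continuous_image) auto
  then obtain B where "\<And>x. x \<in> cbox a b \<Longrightarrow> norm (f x) \<le> B"
    by (auto simp: bounded_iff)
  then show ?thesis
    using box_subset_cbox[of a b] continuous_on_subset[OF assms box_subset_cbox]
    by (intro L2_bounded[where B = B] continuous_imp_measurable_on_sets_lebesgue) auto
qed

lemma test_function_L2:
  assumes "\<psi> \<in> test_functions \<Omega>"
  shows "\<psi> \<in> L2 (lebesgue_on (box a b))"
  using assms by (auto simp: test_functions_def intro!: continuous_L2_box smooth_continuous)

lemma test_function_derivative_L2:
  assumes "\<psi> \<in> test_functions \<Omega>" "i \<in> Basis"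
  shows "(\<lambda>x. frechet_derivative \<psi> (at x) i) \<in> L2 (lebesgue_on (box a b))"
  using assms by (auto simp: test_functions_def intro!: continuous_L2_box smooth_continuous_derivative)

lemma L2_inner_right:
  assumes "g \<in> L2 M"
  shows "(\<lambda>x. g x \<bullet> i) \<in> L2 M"
proof -
  have [measurable]: "g \<in> borel_measurable M" using assms by (rule L2_measurable)
  have "integrable M (\<lambda>x. (norm (g x \<bullet> i))\<^sup>2)"
  proof (rule Bochner_Integration.integrable_bound)
    show "integrable M (\<lambda>x. (norm i)\<^sup>2 * (norm (g x))\<^sup>2)"
      using assms by (auto simp: L2_def)
    show "AE x in M. norm ((norm (g x \<bullet> i))\<^sup>2) \<le> norm ((norm i)\<^sup>2 * (norm (g x))\<^sup>2)"
    proof (rule AE_I2)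
      fix x
      have "\<bar>g x \<bullet> i\<bar>\<^sup>2 \<le> (norm (g x) * norm i)\<^sup>2"
        by (intro power_mono Cauchy_Schwarz_ineq2) auto
      then show "norm ((norm (g x \<bullet> i))\<^sup>2) \<le> norm ((norm i)\<^sup>2 * (norm (g x))\<^sup>2)"
        by (simp add: power_mult_distrib mult.commute)
    qed
  qed auto
  then show ?thesis by (simp add: L2_def)
qed

text \<open>The fundamental lemma applied to each coordinate of \<open>g - h\<close>. Since
  \<open>weak_gradient\<close> is chosen by \<open>SOME\<close>, this is the means by which a chosen
  gradient is identified with a computed one.\<close>

lemma weak_gradient_unique:
  assumes g: "g \<in> L2 (lebesgue_on (box a b))" "has_weak_gradient (box a b) u g"
    and h: "h \<in> L2 (lebesgue_on (box a b))" "has_weak_gradient (box a b) u h"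
  shows "AE x in lebesgue_on (box a b). g x = h x"
proof -
  let ?M = "lebesgue_on (box a b)"
  interpret finite_measure ?M by (rule finite_measure_lebesgue_on_box)
  have "AE x in ?M. (g x - h x) \<bullet> i = 0" if i: "i \<in> Basis" for i
  proof (rule AE_0_if_orthogonal_to_test_functions)
    show "integrable ?M (\<lambda>x. (g x - h x) \<bullet> i)"
      using g h by (intro L2_integrable L2_inner_right L2_diff)
    fix \<psi> assume \<psi>: "\<psi> \<in> test_functions (box a b)"
    have int: "integrable ?M (\<lambda>x. (g x \<bullet> i) * \<psi> x)" "integrable ?M (\<lambda>x. (h x \<bullet> i) * \<psi> x)"
      by (intro L2_integrable_mult[OF _ test_function_L2[OF \<psi>]] L2_inner_right g h)+
    have "(\<integral>x. (g x \<bullet> i) * \<psi> x \<partial>?M) = (\<integral>x. (h x \<bullet> i) * \<psi> x \<partial>?M)"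
      using g(2) h(2) \<psi> i by (simp add: has_weak_gradient_def)
    then show "(\<integral>x. ((g x - h x) \<bullet> i) * \<psi> x \<partial>?M) = 0"
      using int by (simp add: inner_diff_left left_diff_distrib)
  qed
  then have "AE x in ?M. \<forall>i\<in>Basis. (g x - h x) \<bullet> i = 0"
    by (intro AE_finite_allI) auto
  then show ?thesis
    by eventually_elim (simp add: euclidean_all_zero_iff)
qed

lemma has_weak_gradient_lincomb:
  assumes "u \<in> L2 (lebesgue_on (box a b))" "v \<in> L2 (lebesgue_on (box a b))"
    and "g \<in> L2 (lebesgue_on (box a b))" "h \<in> L2 (lebesgue_on (box a b))"
    and "has_weak_gradient (box a b) u g" "has_weak_gradient (box a b) v h"
  shows "has_weak_gradient (box a b) (\<lambda>x. u x + t * v x) (\<lambda>x. g x + t *\<^sub>R h x)"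
  unfolding has_weak_gradient_def
proof (intro ballI)
  let ?M = "lebesgue_on (box a b)"
  fix \<psi> i assume \<psi>: "\<psi> \<in> test_functions (box a b)" and i: "i \<in> (Basis :: 'a set)"
  have [simp]: "integrable ?M (\<lambda>x. (g x \<bullet> i) * \<psi> x)" "integrable ?M (\<lambda>x. (h x \<bullet> i) * \<psi> x)"
    "integrable ?M (\<lambda>x. u x * frechet_derivative \<psi> (at x) i)"
    "integrable ?M (\<lambda>x. v x * frechet_derivative \<psi> (at x) i)"
    by (intro L2_integrable_mult[OF _ test_function_L2[OF \<psi>]]
        L2_integrable_mult[OF _ test_function_derivative_L2[OF \<psi> i]] L2_inner_right assms)+
  have "(\<integral>x. (u x + t * v x) * frechet_derivative \<psi> (at x) i \<partial>?M) =
      (\<integral>x. u x * frechet_derivative \<psi> (at x) i \<partial>?M) + t * (\<integral>x. v x * frechet_derivative \<psi> (at x) i \<partial>?M)"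
    by (simp add: distrib_right mult.assoc)
  also have "\<dots> = - ((\<integral>x. (g x \<bullet> i) * \<psi> x \<partial>?M) + t * (\<integral>x. (h x \<bullet> i) * \<psi> x \<partial>?M))"
    using assms(5,6) \<psi> i by (simp add: has_weak_gradient_def)
  also have "\<dots> = - (\<integral>x. ((g x + t *\<^sub>R h x) \<bullet> i) * \<psi> x \<partial>?M)"
    by (simp add: inner_add_left distrib_right mult.assoc)
  finally show "(\<integral>x. (u x + t * v x) * frechet_derivative \<psi> (at x) i \<partial>?M)
     = - (\<integral>x. ((g x + t *\<^sub>R h x) \<bullet> i) * \<psi> x \<partial>?M)" .
qed

lemma L2_tendsto_integral_mult:
  fixes w :: "'a \<Rightarrow> real"
  assumes "\<And>n. F n \<in> L2 M" "f \<in> L2 M" "w \<in> L2 M"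
    and "(\<lambda>n. L2_norm M (\<lambda>x. F n x - f x)) \<longlonglongrightarrow> 0"
  shows "(\<lambda>n. \<integral>x. F n x * w x \<partial>M) \<longlonglongrightarrow> (\<integral>x. f x * w x \<partial>M)"
proof -
  have "\<forall>\<^sub>F n in sequentially. norm ((\<integral>x. F n x * w x \<partial>M) - (\<integral>x. f x * w x \<partial>M))
      \<le> L2_norm M (\<lambda>x. F n x - f x) * L2_norm M w"
  proof (intro always_eventually allI)
    fix n
    have "(\<integral>x. F n x * w x \<partial>M) - (\<integral>x. f x * w x \<partial>M) = (\<integral>x. (F n x - f x) * w x \<partial>M)"
      using assms by (simp add: left_diff_distrib L2_integrable_mult)
    then show "norm ((\<integral>x. F n x * w x \<partial>M) - (\<integral>x. f x * w x \<partial>M))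
        \<le> L2_norm M (\<lambda>x. F n x - f x) * L2_norm M w"
      using L2_Cauchy_Schwarz_mult[OF L2_diff[OF assms(1)[of n] assms(2)] assms(3)] by simp
  qed
  from Lim_null_comparison[OF this tendsto_mult_left_zero[OF assms(4)]]
  show ?thesis by (rule LIM_zero_cancel)
qed

lemma L2_norm_inner_le:
  assumes "g \<in> L2 M" "norm i \<le> 1"
  shows "L2_norm M (\<lambda>x. g x \<bullet> i) \<le> L2_norm M g"
  unfolding L2_norm_def
proof (intro real_sqrt_le_mono integral_mono)
  show "integrable M (\<lambda>x. (norm (g x \<bullet> i))\<^sup>2)" "integrable M (\<lambda>x. (norm (g x))\<^sup>2)"
    using assms by (intro L2_integrable_square L2_inner_right; simp)+
  fix x
  have "\<bar>g x \<bullet> i\<bar> \<le> norm (g x) * norm i" by (rule Cauchy_Schwarz_ineq2)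
  also have "\<dots> \<le> norm (g x)" using assms(2) by (simp add: mult_left_le)
  finally show "(norm (g x \<bullet> i))\<^sup>2 \<le> (norm (g x))\<^sup>2" by (intro power_mono) auto
qed

text \<open>The weak gradient is a closed operator: for a fixed test function both sides of its
  defining identity are \<open>L2\<close> pairings, which are continuous. Completeness of H1 rests
  on this.\<close>

lemma has_weak_gradient_limit:
  assumes L2: "\<And>n. u n \<in> L2 (lebesgue_on (box a b))" "v \<in> L2 (lebesgue_on (box a b))"
      "\<And>n. g n \<in> L2 (lebesgue_on (box a b))" "h \<in> L2 (lebesgue_on (box a b))"
    and wg: "\<And>n. has_weak_gradient (box a b) (u n) (g n)"
    and lim: "(\<lambda>n. L2_norm (lebesgue_on (box a b)) (\<lambda>x. u n x - v x)) \<longlonglongrightarrow> 0"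
      "(\<lambda>n. L2_norm (lebesgue_on (box a b)) (\<lambda>x. g n x - h x)) \<longlonglongrightarrow> 0"
  shows "has_weak_gradient (box a b) v h"
  unfolding has_weak_gradient_def
proof (intro ballI)
  let ?M = "lebesgue_on (box a b)"
  fix \<psi> i assume \<psi>: "\<psi> \<in> test_functions (box a b)" and i: "i \<in> (Basis :: 'a set)"
  have "(\<lambda>n. L2_norm ?M (\<lambda>x. g n x \<bullet> i - h x \<bullet> i)) \<longlonglongrightarrow> 0"
    using L2_norm_inner_le[OF L2_diff[OF L2(3,4)], of i] i
    by (intro tendsto_sandwich[OF _ _ tendsto_const lim(2)]) (auto simp: inner_diff_left)
  then have G: "(\<lambda>n. \<integral>x. (g n x \<bullet> i) * \<psi> x \<partial>?M) \<longlonglongrightarrow> (\<integral>x. (h x \<bullet> i) * \<psi> x \<partial>?M)"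
    using L2 \<psi> by (intro L2_tendsto_integral_mult L2_inner_right) (auto intro: test_function_L2)
  have U: "(\<lambda>n. \<integral>x. u n x * frechet_derivative \<psi> (at x) i \<partial>?M)
      \<longlonglongrightarrow> (\<integral>x. v x * frechet_derivative \<psi> (at x) i \<partial>?M)"
    using L2 lim(1) \<psi> i by (intro L2_tendsto_integral_mult) (auto intro: test_function_derivative_L2)
  have "(\<integral>x. u n x * frechet_derivative \<psi> (at x) i \<partial>?M) = - (\<integral>x. (g n x \<bullet> i) * \<psi> x \<partial>?M)" for n
    using wg \<psi> i by (simp add: has_weak_gradient_def)
  with tendsto_minus[OF G] have "(\<lambda>n. \<integral>x. u n x * frechet_derivative \<psi> (at x) i \<partial>?M)
      \<longlonglongrightarrow> - (\<integral>x. (h x \<bullet> i) * \<psi> x \<partial>?M)" by simp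
  from LIMSEQ_unique[OF U this] show "(\<integral>x. v x * frechet_derivative \<psi> (at x) i \<partial>?M) = - (\<integral>x. (h x \<bullet> i) * \<psi> x \<partial>?M)" .
qed

section \<open>The square\<close>

lemma Omega_eq_box: "Omega L = box (0, 0) (L, L)"
  by (auto simp: Omega_def mem_box Basis_prod_def)

lemma continuous_L2_Omega:
  fixes f :: "real \<times> real \<Rightarrow> 'b::euclidean_space"
  shows "continuous_on UNIV f \<Longrightarrow> f \<in> L2 (lebesgue_on (Omega L))"
  unfolding Omega_eq_box by (intro continuous_L2_box) (rule continuous_on_subset, auto)

lemma finite_measure_Omega: "finite_measure (lebesgue_on (Omega L))"
  unfolding Omega_eq_box by (rule finite_measure_lebesgue_on_box)

lemma continuous_on_slice:
  assumes "continuous_on UNIV (f :: real \<times> real \<Rightarrow> 'b::topological_space)"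
  shows "continuous_on A (\<lambda>x. f (x, y))" "continuous_on A (\<lambda>x. f (y, x))"
  by (auto intro!: continuous_on_compose2[OF assms] continuous_intros)

text \<open>Both orders of integration are needed, because a partial derivative is to be integrated
  first along its own direction. The third claim allows the inner integrals to be compared pointwise
  under the outer one.\<close>

lemma integral_Omega_continuous:
  fixes f :: "real \<times> real \<Rightarrow> real"
  assumes f: "continuous_on UNIV f"
  shows "(\<integral>z. f z \<partial>lebesgue_on (Omega L)) = integral {0..L} (\<lambda>x. integral {0..L} (\<lambda>y. f (x, y)))" (is ?A)
    and "(\<integral>z. f z \<partial>lebesgue_on (Omega L)) = integral {0..L} (\<lambda>y. integral {0..L} (\<lambda>x. f (x, y)))" (is ?B)
    and "(\<lambda>y. integral {0..L} (\<lambda>x. f (x, y))) integrable_on {0..L}" (is ?C)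
proof -
  interpret finite_measure "lebesgue_on (Omega L)" by (rule finite_measure_Omega)
  have cont: "continuous_on A f" for A using f continuous_on_subset by blast
  have "(\<integral>z. f z \<partial>lebesgue_on (Omega L)) = integral (Omega L) f"
    by (intro lebesgue_integral_eq_integral L2_integrable continuous_L2_Omega f) (simp add: Omega_eq_box)
  also have "\<dots> = integral (cbox (0, 0) (L, L)) f"
    unfolding Omega_eq_box by (rule integral_open_interval)
  also have "\<dots> = integral (cbox 0 L) (\<lambda>x. integral (cbox 0 L) (\<lambda>y. f (x, y)))"
    by (rule integral_prod_continuous) (rule cont)
  finally show A: ?A by simp
  have swap: "continuous_on A (\<lambda>(x, y). f (y, x))" for A
    unfolding case_prod_unfold by (auto intro!: continuous_on_compose2[OF f] continuous_intros)
  show ?B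
    unfolding A using integral_swap_continuous[of 0 0 L L "\<lambda>x y. f (x, y)"] cont by simp
  show ?C
    using integral_integrable_2dim[of 0 0 L L "\<lambda>(x, y). f (y, x)"] swap by simp
qed

section \<open>Integration by parts on the square\<close>

lemma smooth_slice_has_derivative:
  fixes f :: "real \<times> real \<Rightarrow> real"
  assumes "smooth f"
  shows "((\<lambda>x. f (x, y)) has_vector_derivative frechet_derivative f (at (x, y)) (1, 0)) (at x within A)"
    and "((\<lambda>y. f (x, y)) has_vector_derivative frechet_derivative f (at (x, y)) (0, 1)) (at y within A)"
proof -
  note f = smooth_has_derivative[OF assms, of "(x, y)"]
  have lin: "frechet_derivative f (at (x, y)) (h *\<^sub>R v) = h *\<^sub>R frechet_derivative f (at (x, y)) v" for h v
    by (rule linear_cmul[OF linear_frechet_derivative]) (rule smooth_differentiable[OF assms])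
  have der: "((\<lambda>x. (x, y)) has_derivative (\<lambda>h. (h, 0))) (at x)"
    by (auto intro!: derivative_eq_intros)
  have eq: "(\<lambda>h. frechet_derivative f (at (x, y)) (h, 0)) = (\<lambda>h. h *\<^sub>R frechet_derivative f (at (x, y)) (1, 0))"
  proof
    fix h show "frechet_derivative f (at (x, y)) (h, 0) = h *\<^sub>R frechet_derivative f (at (x, y)) (1, 0)"
      using lin[of h "(1, 0)"] by (simp only: scaleR_Pair scaleR_zero_right real_scaleR_def mult_1_right mult_zero_right)
  qed
  from has_derivative_compose[OF der f]
  show "((\<lambda>x. f (x, y)) has_vector_derivative frechet_derivative f (at (x, y)) (1, 0)) (at x within A)"
    unfolding has_vector_derivative_def eq by (rule has_derivative_at_withinI)
  have der: "((\<lambda>y. (x, y)) has_derivative (\<lambda>h. (0, h))) (at y)"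
    by (auto intro!: derivative_eq_intros)
  have eq: "(\<lambda>h. frechet_derivative f (at (x, y)) (0, h)) = (\<lambda>h. h *\<^sub>R frechet_derivative f (at (x, y)) (0, 1))"
  proof
    fix h show "frechet_derivative f (at (x, y)) (0, h) = h *\<^sub>R frechet_derivative f (at (x, y)) (0, 1)"
      using lin[of h "(0, 1)"] by (simp only: scaleR_Pair scaleR_zero_right real_scaleR_def mult_1_right mult_zero_right)
  qed
  from has_derivative_compose[OF der f]
  show "((\<lambda>y. f (x, y)) has_vector_derivative frechet_derivative f (at (x, y)) (0, 1)) (at y within A)"
    unfolding has_vector_derivative_def eq by (rule has_derivative_at_withinI)
qed

lemma Basis_plane: "(Basis :: (real \<times> real) set) = {(1, 0), (0, 1)}"
  by (auto simp: Basis_prod_def)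

text \<open>On each line the fundamental theorem of calculus leaves two values at boundary points,
  which lie outside the open square.\<close>

lemma integral_derivative_eq_0:
  assumes L: "L > 0" and F: "smooth F" and out: "\<And>z. z \<notin> Omega L \<Longrightarrow> F z = 0" and i: "i \<in> Basis"
  shows "(\<integral>z. frechet_derivative F (at z) i \<partial>lebesgue_on (Omega L)) = 0"
proof -
  note cont = smooth_continuous_derivative[OF F i, of UNIV]
  consider "i = (1, 0)" | "i = (0, 1)" using i by (auto simp: Basis_plane)
  then show ?thesis
  proof cases
    case 1
    have "integral {0..L} (\<lambda>x. frechet_derivative F (at (x, y)) (1, 0)) = F (L, y) - F (0, y)" for y
      using L by (intro integral_unique fundamental_theorem_of_calculus smooth_slice_has_derivative F) simp
    then have "integral {0..L} (\<lambda>x. frechet_derivative F (at (x, y)) (1, 0)) = 0" for y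
      by (simp add: out Omega_def)
    then show ?thesis
      using integral_Omega_continuous(2)[OF cont, of L] 1 by simp
  next
    case 2
    have "integral {0..L} (\<lambda>y. frechet_derivative F (at (x, y)) (0, 1)) = F (x, L) - F (x, 0)" for x
      using L by (intro integral_unique fundamental_theorem_of_calculus smooth_slice_has_derivative F) simp
    then have "integral {0..L} (\<lambda>y. frechet_derivative F (at (x, y)) (0, 1)) = 0" for x
      by (simp add: out Omega_def)
    then show ?thesis
      using integral_Omega_continuous(1)[OF cont, of L] 2 by simp
  qed
qed

definition grad :: "(real \<times> real \<Rightarrow> real) \<Rightarrow> real \<times> real \<Rightarrow> real \<times> real" where
  "grad f z = (frechet_derivative f (at z) (1, 0), frechet_derivative f (at z) (0, 1))"

lemma grad_inner_Basis: "i \<in> Basis \<Longrightarrow> grad f z \<bullet> i = frechet_derivative f (at z) i"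
  by (auto simp: grad_def Basis_plane)

lemma grad_L2:
  assumes "smooth f"
  shows "grad f \<in> L2 (lebesgue_on (Omega L))"
  unfolding grad_def[abs_def]
  by (intro continuous_L2_Omega continuous_on_Pair smooth_continuous_derivative assms)
     (auto simp: Basis_plane)

lemma smooth_L2:
  fixes f :: "real \<times> real \<Rightarrow> real"
  shows "smooth f \<Longrightarrow> f \<in> L2 (lebesgue_on (Omega L))"
  by (intro continuous_L2_Omega smooth_continuous)

text \<open>The product of \<open>f\<close> with a test function vanishes off the square, so its
  derivatives integrate to zero; the product rule then gives integration by parts.\<close>

lemma smooth_has_weak_gradient:
  assumes L: "L > 0" and f: "smooth f"
  shows "has_weak_gradient (Omega L) f (grad f)"
  unfolding has_weak_gradient_def
proof (intro ballI)
  let ?M = "lebesgue_on (Omega L)"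
  fix \<psi> :: "real \<times> real \<Rightarrow> real" and i :: "real \<times> real"
  assume \<psi>: "\<psi> \<in> test_functions (Omega L)" and i: "i \<in> Basis"
  have s: "smooth \<psi>" using \<psi> by (simp add: test_functions_def)
  have int: "integrable ?M (\<lambda>z. f z * frechet_derivative \<psi> (at z) i)"
     "integrable ?M (\<lambda>z. frechet_derivative f (at z) i * \<psi> z)"
    by (intro L2_integrable_mult continuous_L2_Omega smooth_continuous smooth_continuous_derivative f s i)+
  have "(\<integral>z. frechet_derivative (\<lambda>z. f z * \<psi> z) (at z) i \<partial>?M) = 0"
  proof (rule integral_derivative_eq_0[OF L smooth_mult[OF f s] _ i])
    fix z assume "z \<notin> Omega L"
    then have "\<psi> z = 0"
      using \<psi> closure_subset[of "{x. \<psi> x \<noteq> 0}"] unfolding test_functions_def by blast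
    then show "f z * \<psi> z = 0" by simp
  qed
  then show "(\<integral>z. f z * frechet_derivative \<psi> (at z) i \<partial>?M) = - (\<integral>z. (grad f z \<bullet> i) * \<psi> z \<partial>?M)"
    using int by (simp add: frechet_derivative_mult smooth_differentiable f s grad_inner_Basis i)
qed

lemma weak_gradient_smooth:
  assumes L: "L > 0" and f: "smooth f"
  shows "AE z in lebesgue_on (Omega L). weak_gradient (Omega L) f z = grad f z"
proof -
  let ?P = "\<lambda>g. g \<in> L2 (lebesgue_on (Omega L)) \<and> has_weak_gradient (Omega L) f g"
  have ex: "?P (grad f)" using grad_L2[OF f] smooth_has_weak_gradient[OF L f] by blast
  from someI[of ?P, OF ex] have "?P (weak_gradient (Omega L) f)" unfolding weak_gradient_def .
  with ex show ?thesis unfolding Omega_eq_box by (intro weak_gradient_unique) auto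
qed

section \<open>Poincare and trace inequalities\<close>

text \<open>Cauchy-Schwarz against the constant 1, read off the discriminant of the integral of (g +
  t)^2.\<close>

lemma square_integral_le:
  fixes g :: "real \<Rightarrow> real"
  assumes "continuous_on {a..b} g" "a \<le> b"
  shows "(integral {a..b} g)\<^sup>2 \<le> (b - a) * integral {a..b} (\<lambda>x. (g x)\<^sup>2)"
proof -
  note int = integrable_continuous_real
  have "(integral {a..b} g)\<^sup>2 \<le> integral {a..b} (\<lambda>x. (g x)\<^sup>2) * (b - a)"
  proof (rule discriminant_nonpos)
    fix t
    have "0 \<le> integral {a..b} (\<lambda>x. (g x + t)\<^sup>2)"
      using assms by (intro integral_nonneg int continuous_intros) auto
    also have "(\<lambda>x. (g x + t)\<^sup>2) = (\<lambda>x. (g x)\<^sup>2 + ((2 * t) * g x + t\<^sup>2))"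
      by (simp add: power2_sum algebra_simps)
    also have "integral {a..b} \<dots> = integral {a..b} (\<lambda>x. (g x)\<^sup>2) + integral {a..b} (\<lambda>x. (2 * t) * g x + t\<^sup>2)"
      using assms by (intro Henstock_Kurzweil_Integration.integral_add int continuous_intros)
    also have "integral {a..b} (\<lambda>x. (2 * t) * g x + t\<^sup>2) = integral {a..b} (\<lambda>x. (2 * t) * g x) + integral {a..b} (\<lambda>x. t\<^sup>2)"
      using assms by (intro Henstock_Kurzweil_Integration.integral_add int continuous_intros)
    finally show "0 \<le> integral {a..b} (\<lambda>x. (g x)\<^sup>2) + 2 * t * integral {a..b} g + t\<^sup>2 * (b - a)"
      using assms by (simp add: mult.commute)
  qed (use assms in simp)
  then show ?thesis by (simp add: mult.commute)
qed

text \<open>The fundamental theorem of calculus and Cauchy-Schwarz on the segment between the two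
  abscissae. Enlarging the segment to the full width makes the bound independent of \<open>s\<close>
  and \<open>t\<close>, so that it can be integrated over either.\<close>

lemma slice_difference_le:
  fixes f :: "real \<times> real \<Rightarrow> real"
  assumes f: "smooth f" and s: "s \<in> {0..L}" and t: "t \<in> {0..L}"
  shows "(f (t, y) - f (s, y))\<^sup>2 \<le> L * integral {0..L} (\<lambda>x. (frechet_derivative f (at (x, y)) (1, 0))\<^sup>2)"
  using s t
proof (induction s t rule: linorder_wlog)
  case (le s t)
  let ?g = "\<lambda>x. frechet_derivative f (at (x, y)) (1, 0)"
  have "continuous_on UNIV (\<lambda>z. frechet_derivative f (at z) (1, 0))"
    by (intro smooth_continuous_derivative[OF f]) (simp add: Basis_plane)
  from continuous_on_slice(1)[OF this] have cont: "continuous_on A ?g" for A .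
  have nn: "0 \<le> integral {0..L} (\<lambda>x. (?g x)\<^sup>2)"
    by (intro integral_nonneg integrable_continuous_real continuous_intros cont) auto
  have "integral {s..t} ?g = f (t, y) - f (s, y)"
    using le by (intro integral_unique fundamental_theorem_of_calculus smooth_slice_has_derivative f) simp
  then have "(f (t, y) - f (s, y))\<^sup>2 \<le> (t - s) * integral {s..t} (\<lambda>x. (?g x)\<^sup>2)"
    using square_integral_le[OF cont le(1)] by simp
  also have "\<dots> \<le> (t - s) * integral {0..L} (\<lambda>x. (?g x)\<^sup>2)"
    using le by (intro mult_left_mono integral_subset_le integrable_continuous_real continuous_intros cont) auto
  also have "\<dots> \<le> L * integral {0..L} (\<lambda>x. (?g x)\<^sup>2)"
    using le nn by (intro mult_right_mono) auto
  finally show ?case .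
next
  case (sym s t)
  then show ?case by (simp add: power2_commute)
qed

text \<open>The Poincare and the trace inequality are both the triangle inequality applied to this bound.\<close>

lemma L2_norm_slice_difference_le:
  assumes L: "L > 0" and f: "smooth f" and c: "c \<in> {0..L}"
  shows "L2_norm (lebesgue_on (Omega L)) (\<lambda>z. f z - f (c, snd z)) \<le> L * L2_norm (lebesgue_on (Omega L)) (grad f)"
proof -
  let ?M = "lebesgue_on (Omega L)"
  let ?g = "\<lambda>z. frechet_derivative f (at z) (1, 0)"
  have cg: "continuous_on UNIV ?g"
    by (intro smooth_continuous_derivative[OF f]) (simp add: Basis_plane)
  have cf: "continuous_on UNIV f" by (rule smooth_continuous[OF f])
  have cd: "continuous_on UNIV (\<lambda>z. (f z - f (c, snd z))\<^sup>2)"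
    by (intro continuous_intros cf continuous_on_compose2[OF cf]) auto
  have cg2: "continuous_on UNIV (\<lambda>z. (?g z)\<^sup>2)" by (intro continuous_intros cg)
  define H where "H y = integral {0..L} (\<lambda>x. (?g (x, y))\<^sup>2)" for y
  have H: "H integrable_on {0..L}"
    using integral_Omega_continuous(3)[OF cg2] by (simp add: H_def[abs_def])
  have "(L2_norm ?M (\<lambda>z. f z - f (c, snd z)))\<^sup>2 = (\<integral>z. (f z - f (c, snd z))\<^sup>2 \<partial>?M)"
    by (simp add: L2_norm_square)
  also have "\<dots> = integral {0..L} (\<lambda>y. integral {0..L} (\<lambda>x. (f (x, y) - f (c, y))\<^sup>2))"
    using integral_Omega_continuous(2)[OF cd] by simp
  also have "\<dots> \<le> integral {0..L} (\<lambda>y. L\<^sup>2 * H y)"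
  proof (rule integral_le)
    show "(\<lambda>y. integral {0..L} (\<lambda>x. (f (x, y) - f (c, y))\<^sup>2)) integrable_on {0..L}"
      using integral_Omega_continuous(3)[OF cd] by simp
    show "(\<lambda>y. L\<^sup>2 * H y) integrable_on {0..L}"
      using integrable_on_cmult_left[OF H, of "L\<^sup>2"] by simp
    fix y
    \<comment> \<open>The bound \<open>L * H y\<close> is constant in x, so integrating it over x
      contributes the second factor L.\<close>
    have "integral {0..L} (\<lambda>x. (f (x, y) - f (c, y))\<^sup>2) \<le> integral {0..L} (\<lambda>x. L * H y)"
      using slice_difference_le[OF f c]
      by (intro integral_le integrable_continuous_real continuous_intros continuous_on_slice cf) (auto simp: H_def)
    also have "\<dots> = L\<^sup>2 * H y" using L by (simp add: power2_eq_square)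
    finally show "integral {0..L} (\<lambda>x. (f (x, y) - f (c, y))\<^sup>2) \<le> L\<^sup>2 * H y" .
  qed
  also have "\<dots> = L\<^sup>2 * (\<integral>z. (?g z)\<^sup>2 \<partial>?M)"
    unfolding integral_Omega_continuous(2)[OF cg2] by (simp add: H_def)
  also have "\<dots> \<le> L\<^sup>2 * (L2_norm ?M (grad f))\<^sup>2"
    unfolding L2_norm_square
  proof (intro mult_left_mono integral_mono)
    show "integrable ?M (\<lambda>z. (?g z)\<^sup>2)"
      using L2_integrable_square[OF continuous_L2_Omega[OF cg]] by simp
    show "integrable ?M (\<lambda>z. (norm (grad f z))\<^sup>2)"
      by (intro L2_integrable_square grad_L2 f)
  qed (auto simp: grad_def norm_Pair)
  finally show ?thesis
    using L by (intro power2_le_imp_le[of "L2_norm ?M _"]) (auto simp: power_mult_distrib)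
qed

section \<open>Arc length on vertical segments\<close>

lemma frontier_Omega:
  assumes "L > 0"
  shows "frontier (Omega L) = {0..L} \<times> {0..L} - {0<..<L} \<times> {0<..<L}"
  using assms by (simp add: Omega_def frontier_def closure_Times interior_Times)

text \<open>A single family for both vertical sides, so that estimates are stated for a general
  abscissa and specialised to 0 and L.\<close>

definition ds :: "real \<Rightarrow> real \<Rightarrow> (real \<times> real) measure" where
  "ds L c = restrict_space (arclength c) ({c} \<times> {0..L})"

lemma ds1_eq: "L > 0 \<Longrightarrow> ds1 L = ds L 0"
  unfolding ds1_def ds_def Gamma1_def by (intro arg_cong2[where f = restrict_space]) (auto simp: frontier_Omega)

lemma ds3_eq: "L > 0 \<Longrightarrow> ds3 L = ds L L"
  unfolding ds3_def ds_def Gamma3_def by (intro arg_cong2[where f = restrict_space]) (auto simp: frontier_Omega)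

lemma segment_borel: "{c} \<times> {0..L} \<in> sets (borel :: (real \<times> real) measure)"
  by (intro borel_closed closed_Times) auto

lemma emeasure_ds: "L > 0 \<Longrightarrow> emeasure (ds L c) (space (ds L c)) = ennreal L"
  using segment_borel[of c L]
  by (simp add: ds_def arclength_def space_restrict_space emeasure_restrict_space emeasure_distr)

lemma finite_measure_ds: "L > 0 \<Longrightarrow> finite_measure (ds L c)"
  by (intro finite_measureI) (simp add: emeasure_ds)

lemma measure_ds: "L > 0 \<Longrightarrow> measure (ds L c) (space (ds L c)) = L"
  by (simp add: measure_def emeasure_ds)

lemma integral_ds_continuous:
  fixes f :: "real \<times> real \<Rightarrow> real"
  assumes f: "continuous_on UNIV f"
  shows "(\<integral>s. f s \<partial>ds L c) = integral {0..L} (\<lambda>y. f (c, y))"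
proof -
  have [measurable]: "f \<in> borel_measurable borel" using f by (rule borel_measurable_continuous_onI)
  have [measurable]: "{c} \<times> {0..L} \<in> sets borel" by (rule segment_borel)
  have "(\<integral>s. f s \<partial>ds L c) = (\<integral>s. indicator ({c} \<times> {0..L}) s *\<^sub>R f s \<partial>arclength c)"
    unfolding ds_def by (intro integral_restrict_space) (simp add: arclength_def)
  also have "\<dots> = (\<integral>y. indicator ({c} \<times> {0..L}) (c, y) *\<^sub>R f (c, y) \<partial>lborel)"
    unfolding arclength_def by (intro integral_distr) measurable
  also have "\<dots> = (\<integral>y. indicator {0..L} y *\<^sub>R f (c, y) \<partial>lborel)"
    by (intro Bochner_Integration.integral_cong) (auto simp: indicator_def)
  also have "\<dots> = integral {0..L} (\<lambda>y. f (c, y))"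
    using set_borel_integral_eq_integral(2)[OF borel_integrable_atLeastAtMost'[OF continuous_on_slice(2)[OF f]]]
    by (simp add: set_lebesgue_integral_def)
  finally show ?thesis .
qed

text \<open>The boundary values are extended constantly in x, so the integral over x contributes
  only the width L, hence the factor sqrt L.\<close>

lemma L2_norm_slice:
  fixes f :: "real \<times> real \<Rightarrow> real"
  assumes L: "L > 0" and f: "continuous_on UNIV f"
  shows "L2_norm (lebesgue_on (Omega L)) (\<lambda>z. f (c, snd z)) = sqrt L * L2_norm (ds L c) f"
proof -
  have c1: "continuous_on UNIV (\<lambda>z. (f (c, snd z))\<^sup>2)"
    by (intro continuous_intros continuous_on_compose2[OF f]) auto
  have c2: "continuous_on UNIV (\<lambda>z. (f z)\<^sup>2)"
    by (intro continuous_intros f)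
  have "(\<integral>z. (f (c, snd z))\<^sup>2 \<partial>lebesgue_on (Omega L)) = L * (\<integral>s. (f s)\<^sup>2 \<partial>ds L c)"
    unfolding integral_Omega_continuous(2)[OF c1] integral_ds_continuous[OF c2] using L by simp
  then show ?thesis by (simp add: L2_norm_def real_sqrt_mult)
qed

lemma slice_L2:
  fixes f :: "real \<times> real \<Rightarrow> real"
  assumes "smooth f"
  shows "(\<lambda>z. f (c, snd z)) \<in> L2 (lebesgue_on (Omega L))"
proof (rule continuous_L2_Omega)
  have "continuous_on UNIV (\<lambda>z::real \<times> real. (c, snd z))" by (intro continuous_intros)
  from continuous_on_compose2[OF smooth_continuous[OF assms, of UNIV] this]
  show "continuous_on UNIV (\<lambda>z::real \<times> real. f (c, snd z))" by simp
qed

lemma smooth_Poincare: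
  assumes "L > 0" "smooth f" "c \<in> {0..L}"
  shows "L2_norm (lebesgue_on (Omega L)) f
    \<le> sqrt L * L2_norm (ds L c) f + L * L2_norm (lebesgue_on (Omega L)) (grad f)"
  using L2_norm_le_add_diff[OF smooth_L2[OF assms(2)] slice_L2[OF assms(2)], of L c]
    L2_norm_slice_difference_le[OF assms] L2_norm_slice[OF assms(1) smooth_continuous[OF assms(2)], of c]
  by simp

lemma smooth_trace_inequality:
  assumes "L > 0" "smooth f" "c \<in> {0..L}"
  shows "sqrt L * L2_norm (ds L c) f
    \<le> L2_norm (lebesgue_on (Omega L)) f + L * L2_norm (lebesgue_on (Omega L)) (grad f)"
  using L2_norm_le_add_diff[OF slice_L2[OF assms(2)] smooth_L2[OF assms(2)], of L c]
    L2_norm_slice_difference_le[OF assms] L2_norm_slice[OF assms(1) smooth_continuous[OF assms(2)], of c]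
    L2_norm_minus_commute[of "lebesgue_on (Omega L)" f "\<lambda>z. f (c, snd z)"]
  by simp

section \<open>The Sobolev space on the square\<close>

lemma L2_norm_tendsto:
  assumes "\<And>n. F n \<in> L2 M" "f \<in> L2 M" "(\<lambda>n. L2_norm M (\<lambda>x. F n x - f x)) \<longlonglongrightarrow> 0"
  shows "(\<lambda>n. L2_norm M (F n)) \<longlonglongrightarrow> L2_norm M f"
proof (rule LIM_zero_cancel, rule Lim_null_comparison[OF _ assms(3)], intro always_eventually allI)
  fix n
  show "norm (L2_norm M (F n) - L2_norm M f) \<le> L2_norm M (\<lambda>x. F n x - f x)"
    using L2_norm_le_add_diff[OF assms(1)[of n] assms(2)] L2_norm_le_add_diff[OF assms(2) assms(1)[of n]]
      L2_norm_minus_commute[of M "F n" f] by simp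
qed

lemma L2_Pair:
  assumes "f \<in> L2 M" "g \<in> L2 M"
  shows "(\<lambda>x. (f x, g x)) \<in> L2 M"
  using assms by (auto simp: L2_def norm_Pair intro!: borel_measurable_Pair)

lemma L2_norm_Pair:
  assumes "f \<in> L2 M" "g \<in> L2 M"
  shows "L2_norm M (\<lambda>x. (f x, g x)) = sqrt ((L2_norm M f)\<^sup>2 + (L2_norm M g)\<^sup>2)"
  unfolding L2_norm_square unfolding L2_norm_def
  using assms by (simp add: norm_Pair L2_integrable_square)

lemma norm_fst_snd_le: "norm (fst z) \<le> norm z" "norm (snd z) \<le> norm z"
  by (metis norm_fst_le norm_snd_le prod.collapse)+

lemma L2_fst_snd:
  assumes "f \<in> L2 M"
  shows "(\<lambda>x. fst (f x)) \<in> L2 M" "(\<lambda>x. snd (f x)) \<in> L2 M"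
proof -
  have [measurable]: "f \<in> borel_measurable M" using assms by (rule L2_measurable)
  have meas: "(\<lambda>x. fst (f x)) \<in> borel_measurable M" "(\<lambda>x. snd (f x)) \<in> borel_measurable M"
    by (auto intro!: borel_measurable_continuous_on[OF _ \<open>f \<in> borel_measurable M\<close>] continuous_intros)
  have "integrable M (\<lambda>x. (norm (fst (f x)))\<^sup>2)" "integrable M (\<lambda>x. (norm (snd (f x)))\<^sup>2)"
    using meas
    by (auto intro!: Bochner_Integration.integrable_bound[OF L2_integrable_square[OF assms]]
        AE_I2 norm_fst_snd_le power_mono)
  with meas show "(\<lambda>x. fst (f x)) \<in> L2 M" "(\<lambda>x. snd (f x)) \<in> L2 M"
    by (auto simp: L2_def)
qed

lemma H1_imp_L2: "u \<in> H1 \<Omega> \<Longrightarrow> u \<in> L2 (lebesgue_on \<Omega>)"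
  by (simp add: H1_def)

lemma weak_gradient_props:
  assumes "u \<in> H1 \<Omega>"
  shows "weak_gradient \<Omega> u \<in> L2 (lebesgue_on \<Omega>)" "has_weak_gradient \<Omega> u (weak_gradient \<Omega> u)"
proof -
  have "\<exists>g. g \<in> L2 (lebesgue_on \<Omega>) \<and> has_weak_gradient \<Omega> u g" using assms by (auto simp: H1_def)
  from someI_ex[OF this]
  show "weak_gradient \<Omega> u \<in> L2 (lebesgue_on \<Omega>)" "has_weak_gradient \<Omega> u (weak_gradient \<Omega> u)"
    unfolding weak_gradient_def by auto
qed

lemma weak_gradient_AE_eq:
  assumes "u \<in> L2 (lebesgue_on (box a b))" "g \<in> L2 (lebesgue_on (box a b))" "has_weak_gradient (box a b) u g"
  shows "u \<in> H1 (box a b)" "AE x in lebesgue_on (box a b). weak_gradient (box a b) u x = g x"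
proof -
  show u: "u \<in> H1 (box a b)" using assms by (auto simp: H1_def)
  show "AE x in lebesgue_on (box a b). weak_gradient (box a b) u x = g x"
    using weak_gradient_props[OF u] assms by (intro weak_gradient_unique)
qed

text \<open>The weak gradients of \<open>u\<close>, of \<open>v\<close> and of their combination are
  three separate choices, so linearity is an almost everywhere statement.\<close>

lemma H1_lincomb:
  assumes u: "u \<in> H1 (box a b)" and v: "v \<in> H1 (box a b)"
  shows "(\<lambda>x. u x + t * v x) \<in> H1 (box a b)"
    and "AE x in lebesgue_on (box a b). weak_gradient (box a b) (\<lambda>x. u x + t * v x) x
      = weak_gradient (box a b) u x + t *\<^sub>R weak_gradient (box a b) v x"
proof -
  note * = has_weak_gradient_lincomb[OF H1_imp_L2[OF u] H1_imp_L2[OF v] weak_gradient_props(1)[OF u]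
      weak_gradient_props(1)[OF v] weak_gradient_props(2)[OF u] weak_gradient_props(2)[OF v]]
  have "(\<lambda>x. u x + t * v x) \<in> L2 (lebesgue_on (box a b))"
    using L2_lincomb[OF H1_imp_L2[OF u] H1_imp_L2[OF v], of t] by simp
  from weak_gradient_AE_eq[OF this L2_lincomb[OF weak_gradient_props(1)[OF u] weak_gradient_props(1)[OF v]] *]
  show "(\<lambda>x. u x + t * v x) \<in> H1 (box a b)"
    and "AE x in lebesgue_on (box a b). weak_gradient (box a b) (\<lambda>x. u x + t * v x) x
      = weak_gradient (box a b) u x + t *\<^sub>R weak_gradient (box a b) v x" .
qed

lemma H1_diff: "u \<in> H1 (box a b) \<Longrightarrow> v \<in> H1 (box a b) \<Longrightarrow> (\<lambda>x. u x - v x) \<in> H1 (box a b)"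
  using H1_lincomb(1)[of u a b v "-1"] by simp

text \<open>The \<open>H1\<close> norm of \<open>u\<close> is the \<open>L2\<close> norm of its 1-jet, which reduces completeness of \<open>H1\<close> to that of \<open>L2\<close>.\<close>

definition jet :: "'a::euclidean_space set \<Rightarrow> ('a \<Rightarrow> real) \<Rightarrow> 'a \<Rightarrow> real \<times> 'a" where
  "jet \<Omega> u x = (u x, weak_gradient \<Omega> u x)"

lemma jet_L2: "u \<in> H1 \<Omega> \<Longrightarrow> jet \<Omega> u \<in> L2 (lebesgue_on \<Omega>)"
  unfolding jet_def[abs_def] by (intro L2_Pair H1_imp_L2 weak_gradient_props)

lemma H1_norm_eq_jet: "u \<in> H1 \<Omega> \<Longrightarrow> H1_norm \<Omega> u = L2_norm (lebesgue_on \<Omega>) (jet \<Omega> u)"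
  unfolding jet_def[abs_def] H1_norm_def by (simp add: L2_norm_Pair H1_imp_L2 weak_gradient_props)

lemma H1_norm_nonneg [simp]: "0 \<le> H1_norm \<Omega> u"
  by (simp add: H1_norm_def)

lemma L2_norm_le_H1_norm: "L2_norm (lebesgue_on \<Omega>) u \<le> H1_norm \<Omega> u"
  "L2_norm (lebesgue_on \<Omega>) (weak_gradient \<Omega> u) \<le> H1_norm \<Omega> u"
  by (auto simp: H1_norm_def intro!: real_le_rsqrt)

lemma H1_norm_lincomb_eq:
  assumes u: "u \<in> H1 (box a b)" and v: "v \<in> H1 (box a b)"
  shows "H1_norm (box a b) (\<lambda>x. u x + t * v x)
    = L2_norm (lebesgue_on (box a b)) (\<lambda>x. jet (box a b) u x + t *\<^sub>R jet (box a b) v x)"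
  unfolding H1_norm_eq_jet[OF H1_lincomb(1)[OF u v]]
proof (rule L2_norm_cong_AE)
  show "jet (box a b) (\<lambda>x. u x + t * v x) \<in> borel_measurable (lebesgue_on (box a b))"
    by (intro L2_measurable jet_L2 H1_lincomb u v)
  show "(\<lambda>x. jet (box a b) u x + t *\<^sub>R jet (box a b) v x) \<in> borel_measurable (lebesgue_on (box a b))"
    by (intro L2_measurable L2_lincomb jet_L2 u v)
  show "AE x in lebesgue_on (box a b). jet (box a b) (\<lambda>x. u x + t * v x) x
      = jet (box a b) u x + t *\<^sub>R jet (box a b) v x"
    using H1_lincomb(2)[OF u v, of t] by eventually_elim (simp add: jet_def)
qed

lemma H1_norm_diff_eq:
  assumes "u \<in> H1 (box a b)" "v \<in> H1 (box a b)"
  shows "H1_norm (box a b) (\<lambda>x. u x - v x)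
    = L2_norm (lebesgue_on (box a b)) (\<lambda>x. jet (box a b) u x - jet (box a b) v x)"
  using H1_norm_lincomb_eq[OF assms, of "-1"] by simp

lemma H1_norm_lincomb_le:
  assumes u: "u \<in> H1 (box a b)" and v: "v \<in> H1 (box a b)"
  shows "H1_norm (box a b) (\<lambda>x. u x + t * v x) \<le> H1_norm (box a b) u + \<bar>t\<bar> * H1_norm (box a b) v"
  unfolding H1_norm_lincomb_eq[OF u v] H1_norm_eq_jet[OF u] H1_norm_eq_jet[OF v]
  using L2_norm_triangle[OF jet_L2[OF u] L2_scaleR[OF jet_L2[OF v], of t]] by (simp add: L2_norm_scaleR)

lemma H1_norm_triangle_diff:
  assumes "u \<in> H1 (box a b)" "v \<in> H1 (box a b)" "w \<in> H1 (box a b)"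
  shows "H1_norm (box a b) (\<lambda>x. u x - w x) \<le> H1_norm (box a b) (\<lambda>x. u x - v x) + H1_norm (box a b) (\<lambda>x. v x - w x)"
  using assms by (simp add: H1_norm_diff_eq L2_norm_triangle_diff jet_L2)

lemma L2_norm_weak_gradient_diff_le:
  assumes u: "u \<in> H1 (box a b)" and v: "v \<in> H1 (box a b)"
  shows "L2_norm (lebesgue_on (box a b)) (\<lambda>x. weak_gradient (box a b) u x - weak_gradient (box a b) v x)
    \<le> H1_norm (box a b) (\<lambda>x. u x - v x)"
proof -
  have "L2_norm (lebesgue_on (box a b)) (\<lambda>x. weak_gradient (box a b) u x - weak_gradient (box a b) v x)
      = L2_norm (lebesgue_on (box a b)) (weak_gradient (box a b) (\<lambda>x. u x - v x))"
  proof (rule L2_norm_cong_AE)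
    show "AE x in lebesgue_on (box a b). weak_gradient (box a b) u x - weak_gradient (box a b) v x
        = weak_gradient (box a b) (\<lambda>x. u x - v x) x"
      using H1_lincomb(2)[OF u v, of "-1"] by eventually_elim simp
  qed (intro L2_measurable L2_diff weak_gradient_props H1_diff u v)+
  then show ?thesis using L2_norm_le_H1_norm(2) by metis
qed

lemma H1_norm_tendsto:
  assumes "\<And>n. X n \<in> H1 (box a b)" "u \<in> H1 (box a b)"
    and "(\<lambda>n. H1_norm (box a b) (\<lambda>x. X n x - u x)) \<longlonglongrightarrow> 0"
  shows "(\<lambda>n. H1_norm (box a b) (X n)) \<longlonglongrightarrow> H1_norm (box a b) u"
    and "(\<lambda>n. L2_norm (lebesgue_on (box a b)) (X n)) \<longlonglongrightarrow> L2_norm (lebesgue_on (box a b)) u"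
    and "(\<lambda>n. L2_norm (lebesgue_on (box a b)) (weak_gradient (box a b) (X n)))
      \<longlonglongrightarrow> L2_norm (lebesgue_on (box a b)) (weak_gradient (box a b) u)"
proof -
  show "(\<lambda>n. H1_norm (box a b) (X n)) \<longlonglongrightarrow> H1_norm (box a b) u"
    using L2_norm_tendsto[of "\<lambda>n. jet (box a b) (X n)", OF jet_L2 jet_L2] assms
    by (simp add: H1_norm_eq_jet H1_norm_diff_eq)
  have "(\<lambda>n. L2_norm (lebesgue_on (box a b)) (\<lambda>x. X n x - u x)) \<longlonglongrightarrow> 0"
    by (rule tendsto_sandwich[OF _ _ tendsto_const assms(3)]) (simp_all add: L2_norm_le_H1_norm(1))
  then show "(\<lambda>n. L2_norm (lebesgue_on (box a b)) (X n)) \<longlonglongrightarrow> L2_norm (lebesgue_on (box a b)) u"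
    using assms by (intro L2_norm_tendsto H1_imp_L2)
  have "(\<lambda>n. L2_norm (lebesgue_on (box a b))
      (\<lambda>x. weak_gradient (box a b) (X n) x - weak_gradient (box a b) u x)) \<longlonglongrightarrow> 0"
    using L2_norm_weak_gradient_diff_le[OF assms(1,2)]
    by (intro tendsto_sandwich[OF _ _ tendsto_const assms(3)]) auto
  then show "(\<lambda>n. L2_norm (lebesgue_on (box a b)) (weak_gradient (box a b) (X n)))
      \<longlonglongrightarrow> L2_norm (lebesgue_on (box a b)) (weak_gradient (box a b) u)"
    using assms by (intro L2_norm_tendsto weak_gradient_props)
qed

lemma L2_norm_fst_snd_le:
  assumes "f \<in> L2 M"
  shows "L2_norm M (\<lambda>x. fst (f x)) \<le> L2_norm M f" "L2_norm M (\<lambda>x. snd (f x)) \<le> L2_norm M f"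
  unfolding L2_norm_def
  by (intro real_sqrt_le_mono integral_mono L2_integrable_square L2_fst_snd assms power_mono
      norm_fst_snd_le norm_ge_zero)+

text \<open>The jets converge in \<open>L2\<close> to a pair. By closedness of the weak gradient the
  second component of the limit is a weak gradient of the first, so the limit is again a jet up to a
  null set.\<close>

lemma H1_complete:
  assumes X: "\<And>n. X n \<in> H1 (box a b)"
    and Cauchy: "\<And>e. 0 < e \<Longrightarrow> \<exists>N. \<forall>m\<ge>N. \<forall>n\<ge>N. H1_norm (box a b) (\<lambda>x. X m x - X n x) < e"
  obtains u where "u \<in> H1 (box a b)" "(\<lambda>n. H1_norm (box a b) (\<lambda>x. X n x - u x)) \<longlonglongrightarrow> 0"
proof -
  let ?M = "lebesgue_on (box a b)"
  interpret finite_measure ?M by (rule finite_measure_lebesgue_on_box)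
  obtain f where f: "f \<in> L2 ?M" and lim: "(\<lambda>n. L2_norm ?M (\<lambda>x. jet (box a b) (X n) x - f x)) \<longlonglongrightarrow> 0"
  proof (rule L2_complete)
    show "jet (box a b) (X n) \<in> L2 ?M" for n by (rule jet_L2[OF X])
    show "\<exists>N. \<forall>m\<ge>N. \<forall>n\<ge>N. L2_norm ?M (\<lambda>x. jet (box a b) (X m) x - jet (box a b) (X n) x) < e"
      if "0 < e" for e
      using Cauchy[OF that] by (simp add: H1_norm_diff_eq X)
  qed
  let ?u = "\<lambda>x. fst (f x)" and ?g = "\<lambda>x. snd (f x)"
  note dL2 = L2_diff[OF jet_L2[OF X] f]
  have "(\<lambda>n. L2_norm ?M (\<lambda>x. X n x - ?u x)) \<longlonglongrightarrow> 0"
    using L2_norm_fst_snd_le(1)[OF dL2]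
    by (intro tendsto_sandwich[OF _ _ tendsto_const lim]) (auto simp: jet_def)
  moreover have "(\<lambda>n. L2_norm ?M (\<lambda>x. weak_gradient (box a b) (X n) x - ?g x)) \<longlonglongrightarrow> 0"
    using L2_norm_fst_snd_le(2)[OF dL2]
    by (intro tendsto_sandwich[OF _ _ tendsto_const lim]) (auto simp: jet_def)
  ultimately have "has_weak_gradient (box a b) ?u ?g"
    by (rule has_weak_gradient_limit[OF H1_imp_L2[OF X] L2_fst_snd(1)[OF f]
        weak_gradient_props(1)[OF X] L2_fst_snd(2)[OF f] weak_gradient_props(2)[OF X]])
  note u = weak_gradient_AE_eq[OF L2_fst_snd[OF f] this]
  have "L2_norm ?M (\<lambda>x. jet (box a b) (X n) x - f x) = H1_norm (box a b) (\<lambda>x. X n x - ?u x)" for n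
    unfolding H1_norm_diff_eq[OF X u(1)]
  proof (rule L2_norm_cong_AE)
    show "AE x in ?M. jet (box a b) (X n) x - f x = jet (box a b) (X n) x - jet (box a b) ?u x"
      using u(2) by eventually_elim (simp add: jet_def)
  qed (intro L2_measurable L2_diff jet_L2 X f u(1))+
  with lim have "(\<lambda>n. H1_norm (box a b) (\<lambda>x. X n x - ?u x)) \<longlonglongrightarrow> 0" by simp
  with u(1) that show ?thesis by blast
qed

section \<open>Traces\<close>

lemma has_trace_lincomb:
  assumes u: "has_trace (box a b) S u h" and v: "has_trace (box a b) S v k"
  shows "has_trace (box a b) S (\<lambda>x. u x + t * v x) (\<lambda>x. h x + t * k x)"
proof -
  let ?\<Omega> = "box a b"
  obtain \<phi> where \<phi>: "\<And>n. smooth (\<phi> n)" "\<And>n. \<phi> n \<in> H1 ?\<Omega>" "\<And>n. \<phi> n \<in> L2 S"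
      "(\<lambda>n. H1_norm ?\<Omega> (\<lambda>x. \<phi> n x - u x)) \<longlonglongrightarrow> 0" "(\<lambda>n. L2_norm S (\<lambda>x. \<phi> n x - h x)) \<longlonglongrightarrow> 0"
    using u unfolding has_trace_def by blast
  obtain \<psi> where \<psi>: "\<And>n. smooth (\<psi> n)" "\<And>n. \<psi> n \<in> H1 ?\<Omega>" "\<And>n. \<psi> n \<in> L2 S"
      "(\<lambda>n. H1_norm ?\<Omega> (\<lambda>x. \<psi> n x - v x)) \<longlonglongrightarrow> 0" "(\<lambda>n. L2_norm S (\<lambda>x. \<psi> n x - k x)) \<longlonglongrightarrow> 0"
    using v unfolding has_trace_def by blast
  have H1: "u \<in> H1 ?\<Omega>" "v \<in> H1 ?\<Omega>" and L2: "h \<in> L2 S" "k \<in> L2 S"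
    using u v by (auto simp: has_trace_def)
  have "(\<lambda>n. H1_norm ?\<Omega> (\<lambda>x. (\<phi> n x + t * \<psi> n x) - (u x + t * v x))) \<longlonglongrightarrow> 0"
  proof (rule tendsto_sandwich[OF _ _ tendsto_const])
    show "(\<lambda>n. H1_norm ?\<Omega> (\<lambda>x. \<phi> n x - u x) + \<bar>t\<bar> * H1_norm ?\<Omega> (\<lambda>x. \<psi> n x - v x)) \<longlonglongrightarrow> 0"
      using tendsto_add[OF \<phi>(4) tendsto_mult_right_zero[OF \<psi>(4)]] by simp
    have "H1_norm ?\<Omega> (\<lambda>x. (\<phi> n x + t * \<psi> n x) - (u x + t * v x))
        \<le> H1_norm ?\<Omega> (\<lambda>x. \<phi> n x - u x) + \<bar>t\<bar> * H1_norm ?\<Omega> (\<lambda>x. \<psi> n x - v x)" for n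
      using H1_norm_lincomb_le[OF H1_diff[OF \<phi>(2) H1(1)] H1_diff[OF \<psi>(2) H1(2)], of n t n]
      by (simp add: algebra_simps)
    then show "\<forall>\<^sub>F n in sequentially. H1_norm ?\<Omega> (\<lambda>x. (\<phi> n x + t * \<psi> n x) - (u x + t * v x))
        \<le> H1_norm ?\<Omega> (\<lambda>x. \<phi> n x - u x) + \<bar>t\<bar> * H1_norm ?\<Omega> (\<lambda>x. \<psi> n x - v x)"
      by simp
  qed simp
  moreover have "(\<lambda>n. L2_norm S (\<lambda>x. (\<phi> n x + t * \<psi> n x) - (h x + t * k x))) \<longlonglongrightarrow> 0"
  proof (rule tendsto_sandwich[OF _ _ tendsto_const])
    show "(\<lambda>n. L2_norm S (\<lambda>x. \<phi> n x - h x) + \<bar>t\<bar> * L2_norm S (\<lambda>x. \<psi> n x - k x)) \<longlonglongrightarrow> 0"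
      using tendsto_add[OF \<phi>(5) tendsto_mult_right_zero[OF \<psi>(5)]] by simp
    have "L2_norm S (\<lambda>x. (\<phi> n x + t * \<psi> n x) - (h x + t * k x))
        \<le> L2_norm S (\<lambda>x. \<phi> n x - h x) + \<bar>t\<bar> * L2_norm S (\<lambda>x. \<psi> n x - k x)" for n
      using L2_norm_triangle[OF L2_diff[OF \<phi>(3) L2(1)] L2_scaleR[OF L2_diff[OF \<psi>(3) L2(2)], of t], of n n]
        L2_norm_scaleR[of S t "\<lambda>x. \<psi> n x - k x"]
      by (simp add: algebra_simps)
    then show "\<forall>\<^sub>F n in sequentially. L2_norm S (\<lambda>x. (\<phi> n x + t * \<psi> n x) - (h x + t * k x))
        \<le> L2_norm S (\<lambda>x. \<phi> n x - h x) + \<bar>t\<bar> * L2_norm S (\<lambda>x. \<psi> n x - k x)"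
      by simp
  qed simp
  moreover have "(\<lambda>x. h x + t * k x) \<in> L2 S" "(\<lambda>x. \<phi> n x + t * \<psi> n x) \<in> L2 S" for n
    using L2_lincomb[OF L2, of t] L2_lincomb[OF \<phi>(3) \<psi>(3), of n t n] by auto
  moreover have "(\<lambda>x. u x + t * v x) \<in> H1 ?\<Omega>" "(\<lambda>x. \<phi> n x + t * \<psi> n x) \<in> H1 ?\<Omega>" for n
    using H1 \<phi> \<psi> by (auto intro: H1_lincomb)
  moreover have "smooth (\<lambda>x. \<phi> n x + t * \<psi> n x)" for n
    using \<phi> \<psi> by (intro smooth_lincomb)
  ultimately show ?thesis
    unfolding has_trace_def by (intro conjI exI[of _ "\<lambda>n x. \<phi> n x + t * \<psi> n x"]) simp_all
qed

text \<open>The trace relation is a closure of restrictions of smooth functions, hence closed. A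
  diagonal sequence shows it: for each n a smooth function within 1 / Suc n of the pair (X n, h n),
  in both norms.\<close>

lemma has_trace_limit:
  assumes X: "\<And>n. has_trace (box a b) S (X n) (h n)" and u: "u \<in> H1 (box a b)" and k: "k \<in> L2 S"
    and lim: "(\<lambda>n. H1_norm (box a b) (\<lambda>x. X n x - u x)) \<longlonglongrightarrow> 0" "(\<lambda>n. L2_norm S (\<lambda>x. h n x - k x)) \<longlonglongrightarrow> 0"
  shows "has_trace (box a b) S u k"
proof -
  let ?\<Omega> = "box a b"
  have XH: "X n \<in> H1 ?\<Omega>" "h n \<in> L2 S" for n using X by (auto simp: has_trace_def)
  have "\<exists>f. smooth f \<and> f \<in> H1 ?\<Omega> \<inter> L2 S \<and> H1_norm ?\<Omega> (\<lambda>x. f x - X n x) < inverse (real (Suc n)) \<and>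
      L2_norm S (\<lambda>x. f x - h n x) < inverse (real (Suc n))" for n
  proof -
    obtain \<phi> where \<phi>: "\<And>j. smooth (\<phi> j) \<and> \<phi> j \<in> H1 ?\<Omega> \<inter> L2 S"
      "(\<lambda>j::nat. H1_norm ?\<Omega> (\<lambda>x. \<phi> j x - X n x)) \<longlonglongrightarrow> 0" "(\<lambda>j. L2_norm S (\<lambda>x. \<phi> j x - h n x)) \<longlonglongrightarrow> 0"
      using X[of n] unfolding has_trace_def by blast
    have "0 < inverse (real (Suc n))" by simp
    from eventually_conj[OF order_tendstoD(2)[OF \<phi>(2) this] order_tendstoD(2)[OF \<phi>(3) this]]
    obtain j where "H1_norm ?\<Omega> (\<lambda>x. \<phi> j x - X n x) < inverse (real (Suc n))"
      "L2_norm S (\<lambda>x. \<phi> j x - h n x) < inverse (real (Suc n))"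
      by (auto simp: eventually_sequentially simp del: of_nat_Suc)
    with \<phi>(1)[of j] show ?thesis by blast
  qed
  then have "\<forall>n. \<exists>f. smooth f \<and> f \<in> H1 ?\<Omega> \<inter> L2 S \<and> H1_norm ?\<Omega> (\<lambda>x. f x - X n x) < inverse (real (Suc n)) \<and>
      L2_norm S (\<lambda>x. f x - h n x) < inverse (real (Suc n))" ..
  from choice[OF this] obtain f where f: "\<And>n. smooth (f n)" "\<And>n. f n \<in> H1 ?\<Omega>" "\<And>n. f n \<in> L2 S"
      "\<And>n. H1_norm ?\<Omega> (\<lambda>x. f n x - X n x) < inverse (real (Suc n))"
      "\<And>n. L2_norm S (\<lambda>x. f n x - h n x) < inverse (real (Suc n))"
    by auto
  have "(\<lambda>n. H1_norm ?\<Omega> (\<lambda>x. f n x - u x)) \<longlonglongrightarrow> 0"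
  proof (rule tendsto_sandwich[OF _ _ tendsto_const])
    show "(\<lambda>n. inverse (real (Suc n)) + H1_norm ?\<Omega> (\<lambda>x. X n x - u x)) \<longlonglongrightarrow> 0"
      using tendsto_add[OF LIMSEQ_inverse_real_of_nat lim(1)] by simp
    have "H1_norm ?\<Omega> (\<lambda>x. f n x - u x) \<le> inverse (real (Suc n)) + H1_norm ?\<Omega> (\<lambda>x. X n x - u x)" for n
      using H1_norm_triangle_diff[OF f(2)[of n] XH(1)[of n] u] f(4)[of n] by linarith
    then show "\<forall>\<^sub>F n in sequentially. H1_norm ?\<Omega> (\<lambda>x. f n x - u x)
        \<le> inverse (real (Suc n)) + H1_norm ?\<Omega> (\<lambda>x. X n x - u x)" by simp
  qed simp
  moreover have "(\<lambda>n. L2_norm S (\<lambda>x. f n x - k x)) \<longlonglongrightarrow> 0"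
  proof (rule tendsto_sandwich[OF _ _ tendsto_const])
    show "(\<lambda>n. inverse (real (Suc n)) + L2_norm S (\<lambda>x. h n x - k x)) \<longlonglongrightarrow> 0"
      using tendsto_add[OF LIMSEQ_inverse_real_of_nat lim(2)] by simp
    have "L2_norm S (\<lambda>x. f n x - k x) \<le> inverse (real (Suc n)) + L2_norm S (\<lambda>x. h n x - k x)" for n
      using L2_norm_triangle_diff[OF f(3)[of n] XH(2)[of n] k] f(5)[of n] by linarith
    then show "\<forall>\<^sub>F n in sequentially. L2_norm S (\<lambda>x. f n x - k x)
        \<le> inverse (real (Suc n)) + L2_norm S (\<lambda>x. h n x - k x)" by simp
  qed simp
  ultimately show ?thesis unfolding has_trace_def using u k f by blast
qed

lemma L2_norm_grad_smooth:
  assumes "L > 0" "smooth f" "f \<in> H1 (Omega L)"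
  shows "L2_norm (lebesgue_on (Omega L)) (grad f) = L2_norm (lebesgue_on (Omega L)) (weak_gradient (Omega L) f)"
proof (rule L2_norm_cong_AE)
  show "AE z in lebesgue_on (Omega L). grad f z = weak_gradient (Omega L) f z"
    using weak_gradient_smooth[OF assms(1,2)] by eventually_elim simp
qed (intro L2_measurable grad_L2 weak_gradient_props assms)+

text \<open>Stated for every \<open>h\<close> related to \<open>u\<close> instead of the chosen
  \<open>trace\<close>, so that uniqueness of traces can be derived from it. The constant 1 + L
  arises because the H1 norm dominates both the function and its gradient.\<close>

lemma trace_inequality:
  assumes L: "L > 0" and c: "c \<in> {0..L}" and u: "has_trace (Omega L) (ds L c) u h"
  shows "sqrt L * L2_norm (ds L c) h \<le> (1 + L) * H1_norm (Omega L) u"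
proof -
  obtain \<phi> where \<phi>: "\<And>n. smooth (\<phi> n)" "\<And>n. \<phi> n \<in> H1 (Omega L)" "\<And>n. \<phi> n \<in> L2 (ds L c)"
      "(\<lambda>n. H1_norm (Omega L) (\<lambda>x. \<phi> n x - u x)) \<longlonglongrightarrow> 0" "(\<lambda>n. L2_norm (ds L c) (\<lambda>x. \<phi> n x - h x)) \<longlonglongrightarrow> 0"
    using u unfolding has_trace_def by blast
  have uH: "u \<in> H1 (Omega L)" and h: "h \<in> L2 (ds L c)" using u by (auto simp: has_trace_def)
  show ?thesis
  proof (rule LIMSEQ_le)
    show "(\<lambda>n. sqrt L * L2_norm (ds L c) (\<phi> n)) \<longlonglongrightarrow> sqrt L * L2_norm (ds L c) h"
      by (intro tendsto_intros L2_norm_tendsto \<phi> h)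
    show "(\<lambda>n. (1 + L) * H1_norm (Omega L) (\<phi> n)) \<longlonglongrightarrow> (1 + L) * H1_norm (Omega L) u"
      using H1_norm_tendsto(1) \<phi>(2,4) uH unfolding Omega_eq_box by (intro tendsto_intros) blast
    have "sqrt L * L2_norm (ds L c) (\<phi> n) \<le> (1 + L) * H1_norm (Omega L) (\<phi> n)" for n
    proof -
      have "sqrt L * L2_norm (ds L c) (\<phi> n) \<le> L2_norm (lebesgue_on (Omega L)) (\<phi> n)
          + L * L2_norm (lebesgue_on (Omega L)) (weak_gradient (Omega L) (\<phi> n))"
        using smooth_trace_inequality[OF L \<phi>(1) c, of n] L2_norm_grad_smooth[OF L \<phi>(1,2)] by simp
      also have "\<dots> \<le> H1_norm (Omega L) (\<phi> n) + L * H1_norm (Omega L) (\<phi> n)"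
        using L by (intro add_mono mult_left_mono L2_norm_le_H1_norm) auto
      finally show ?thesis by (simp add: algebra_simps)
    qed
    then show "\<exists>N. \<forall>n\<ge>N. sqrt L * L2_norm (ds L c) (\<phi> n) \<le> (1 + L) * H1_norm (Omega L) (\<phi> n)" by blast
  qed
qed

text \<open>The smooth approximants need not vanish on the side, so the boundary term of
  \<open>smooth_Poincare\<close> is kept for them; it tends to zero because the trace of
  \<open>u\<close> is zero.\<close>

lemma Poincare_inequality:
  assumes L: "L > 0" and c: "c \<in> {0..L}" and u: "has_trace (Omega L) (ds L c) u (\<lambda>_. 0)"
  shows "L2_norm (lebesgue_on (Omega L)) u \<le> L * L2_norm (lebesgue_on (Omega L)) (weak_gradient (Omega L) u)"
proof -
  obtain \<phi> where \<phi>: "\<And>n. smooth (\<phi> n)" "\<And>n. \<phi> n \<in> H1 (Omega L)"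
      "(\<lambda>n. H1_norm (Omega L) (\<lambda>x. \<phi> n x - u x)) \<longlonglongrightarrow> 0" "(\<lambda>n. L2_norm (ds L c) (\<phi> n)) \<longlonglongrightarrow> 0"
    using u unfolding has_trace_def by auto
  have uH: "u \<in> H1 (Omega L)" using u by (auto simp: has_trace_def)
  note lim = H1_norm_tendsto[of \<phi> "(0, 0)" "(L, L)" u, folded Omega_eq_box, OF \<phi>(2) uH \<phi>(3)]
  show ?thesis
  proof (rule LIMSEQ_le)
    show "(\<lambda>n. L2_norm (lebesgue_on (Omega L)) (\<phi> n)) \<longlonglongrightarrow> L2_norm (lebesgue_on (Omega L)) u"
      by (rule lim)
    show "(\<lambda>n. sqrt L * L2_norm (ds L c) (\<phi> n) + L * L2_norm (lebesgue_on (Omega L)) (weak_gradient (Omega L) (\<phi> n)))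
        \<longlonglongrightarrow> L * L2_norm (lebesgue_on (Omega L)) (weak_gradient (Omega L) u)"
      using tendsto_add[OF tendsto_mult_right_zero[OF \<phi>(4), of "sqrt L"] tendsto_mult_left[OF lim(3), of L]] by simp
    show "\<exists>N. \<forall>n\<ge>N. L2_norm (lebesgue_on (Omega L)) (\<phi> n) \<le> sqrt L * L2_norm (ds L c) (\<phi> n)
        + L * L2_norm (lebesgue_on (Omega L)) (weak_gradient (Omega L) (\<phi> n))"
      using smooth_Poincare[OF L \<phi>(1) c] L2_norm_grad_smooth[OF L \<phi>(1,2)] by simp
  qed
qed

text \<open>Two traces of \<open>u\<close> differ by a trace of u - u, to which the trace inequality
  applies.\<close>

lemma has_trace_unique:
  assumes L: "L > 0" and c: "c \<in> {0..L}"
    and h: "has_trace (Omega L) (ds L c) u h" and k: "has_trace (Omega L) (ds L c) u k"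
  shows "AE s in ds L c. h s = k s"
proof -
  have uH: "u \<in> H1 (box (0, 0) (L, L))" and L2: "h \<in> L2 (ds L c)" "k \<in> L2 (ds L c)"
    using h k by (auto simp: has_trace_def Omega_eq_box)
  have "has_trace (Omega L) (ds L c) (\<lambda>x. u x - u x) (\<lambda>s. h s - k s)"
    using has_trace_lincomb[OF h[unfolded Omega_eq_box] k[unfolded Omega_eq_box], of "-1"]
    by (simp add: Omega_eq_box)
  \<comment> \<open>The weak gradient chosen for the zero function need not be zero everywhere;
    rewriting the norm as that of a difference of equal jets makes it zero directly.\<close>
  from trace_inequality[OF L c this] have "sqrt L * L2_norm (ds L c) (\<lambda>s. h s - k s) \<le> 0"
    unfolding Omega_eq_box H1_norm_diff_eq[OF uH uH] by (simp add: L2_norm_def)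
  then have "L2_norm (ds L c) (\<lambda>s. h s - k s) = 0"
    using L by (simp add: mult_le_0_iff order_antisym)
  from L2_norm_eq_0_imp_AE[OF L2_diff[OF L2] this] show ?thesis by eventually_elim simp
qed

section \<open>The variational problem\<close>

lemma Vc_iff:
  assumes "L > 0"
  shows "u \<in> Vc L \<longleftrightarrow> (\<exists>c. has_trace (Omega L) (ds L 0) u (\<lambda>_. c)) \<and> has_trace (Omega L) (ds L L) u (\<lambda>_. 0)"
  using assms by (auto simp: Vc_def ds1_eq ds3_eq has_trace_def)

lemma Vc_H1: "u \<in> Vc L \<Longrightarrow> u \<in> H1 (Omega L)"
  by (simp add: Vc_def)

lemma L2_norm_const_ds:
  assumes "L > 0"
  shows "L2_norm (ds L c) (\<lambda>_. b :: real) = \<bar>b\<bar> * sqrt L"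
  using assms by (simp add: L2_norm_def measure_ds real_sqrt_mult mult.commute)

lemma const_L2_ds: "L > 0 \<Longrightarrow> (\<lambda>_. b) \<in> L2 (ds L c)"
  by (rule finite_measure.L2_const[OF finite_measure_ds])

text \<open>Uniqueness of traces makes the constant well defined on \<open>Vc L\<close>, since the
  side has positive length. It replaces boundary integrals by scalars.\<close>

definition bval :: "real \<Rightarrow> (real \<times> real \<Rightarrow> real) \<Rightarrow> real" where
  "bval L u = (THE c. has_trace (Omega L) (ds L 0) u (\<lambda>_. c))"

lemma bval_eq:
  assumes L: "L > 0" and c: "has_trace (Omega L) (ds L 0) u (\<lambda>_. c)"
  shows "bval L u = c"
  unfolding bval_def
proof (rule the_equality)
  fix d assume d: "has_trace (Omega L) (ds L 0) u (\<lambda>_. d)"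
  have "AE s in ds L 0. d - c = 0"
    using has_trace_unique[OF L _ d c] L by simp
  then have "L2_norm (ds L 0) (\<lambda>_. d - c) = L2_norm (ds L 0) (\<lambda>_. 0 :: real)"
    by (intro L2_norm_cong_AE) auto
  then show "d = c" using L by (simp add: L2_norm_const_ds)
qed (rule c)

lemma has_trace_bval:
  assumes L: "L > 0" and u: "u \<in> Vc L"
  shows "has_trace (Omega L) (ds L 0) u (\<lambda>_. bval L u)"
  using u bval_eq[OF L] unfolding Vc_iff[OF L] by metis

text \<open>One factor sqrt L comes from the trace inequality and one from the norm of a constant on
  a side of length L; together they give the denominator L.\<close>

lemma bval_bound:
  assumes L: "L > 0" and u: "u \<in> Vc L"
  shows "\<bar>bval L u\<bar> \<le> (1 + L) / L * H1_norm (Omega L) u"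
proof -
  have "sqrt L * (\<bar>bval L u\<bar> * sqrt L) \<le> (1 + L) * H1_norm (Omega L) u"
    using trace_inequality[OF L _ has_trace_bval[OF L u]] L by (simp add: L2_norm_const_ds)
  moreover have "sqrt L * (\<bar>bval L u\<bar> * sqrt L) = (sqrt L * sqrt L) * \<bar>bval L u\<bar>"
    by (simp only: ac_simps)
  ultimately have "L * \<bar>bval L u\<bar> \<le> (1 + L) * H1_norm (Omega L) u"
    using L by simp
  then show ?thesis using L by (simp add: field_simps)
qed

lemma Vc_lincomb:
  assumes L: "L > 0" and u: "u \<in> Vc L" and v: "v \<in> Vc L"
  shows "(\<lambda>x. u x + t * v x) \<in> Vc L" "bval L (\<lambda>x. u x + t * v x) = bval L u + t * bval L v"
proof -
  have 1: "has_trace (Omega L) (ds L 0) (\<lambda>x. u x + t * v x) (\<lambda>_. bval L u + t * bval L v)"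
    using has_trace_lincomb has_trace_bval[OF L u] has_trace_bval[OF L v] unfolding Omega_eq_box by blast
  have "has_trace (Omega L) (ds L L) (\<lambda>x. u x + t * v x) (\<lambda>_. 0 + t * 0)"
    using u v unfolding Vc_iff[OF L] Omega_eq_box by (intro has_trace_lincomb) auto
  with 1 show "(\<lambda>x. u x + t * v x) \<in> Vc L" unfolding Vc_iff[OF L] by auto
  show "bval L (\<lambda>x. u x + t * v x) = bval L u + t * bval L v" by (rule bval_eq[OF L 1])
qed

lemma Vc_diff: "L > 0 \<Longrightarrow> u \<in> Vc L \<Longrightarrow> v \<in> Vc L \<Longrightarrow> (\<lambda>x. u x - v x) \<in> Vc L"
  "L > 0 \<Longrightarrow> u \<in> Vc L \<Longrightarrow> v \<in> Vc L \<Longrightarrow> bval L (\<lambda>x. u x - v x) = bval L u - bval L v"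
  using Vc_lincomb[of L u v "-1"] by auto

lemma has_trace_zero: "has_trace (box a b) S (\<lambda>_. 0) (\<lambda>_. 0)"
proof -
  have wg: "has_weak_gradient (box a b) (\<lambda>_. 0) (\<lambda>_. 0)" by (simp add: has_weak_gradient_def)
  have H: "(\<lambda>_. 0) \<in> H1 (box a b)" by (rule weak_gradient_AE_eq(1)[OF L2_zero L2_zero wg])
  have "H1_norm (box a b) (\<lambda>x. 0 - 0) = 0"
    unfolding H1_norm_diff_eq[OF H H] by (simp add: L2_norm_def)
  then show ?thesis
    unfolding has_trace_def using H
    by (intro conjI exI[of _ "\<lambda>n x. 0"]) (auto simp: L2_zero smooth_const L2_norm_def)
qed

lemma zero_in_Vc:
  assumes L: "L > 0"
  shows "(\<lambda>_. 0) \<in> Vc L"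
  unfolding Vc_iff[OF L] Omega_eq_box by (intro conjI exI[of _ 0] has_trace_zero)

text \<open>The point is that the limit again has a constant trace on x = 0: by
  \<open>bval_bound\<close> the boundary constants form a Cauchy sequence of reals, and their limit
  is a trace of \<open>u\<close> by closedness of the trace relation.\<close>

lemma Vc_complete:
  assumes L: "L > 0" and X: "\<And>n. X n \<in> Vc L"
    and Cauchy: "\<And>e. 0 < e \<Longrightarrow> \<exists>N. \<forall>m\<ge>N. \<forall>n\<ge>N. H1_norm (Omega L) (\<lambda>x. X m x - X n x) < e"
  obtains u where "u \<in> Vc L" "(\<lambda>n. H1_norm (Omega L) (\<lambda>x. X n x - u x)) \<longlonglongrightarrow> 0"
proof -
  obtain u where u: "u \<in> H1 (Omega L)" "(\<lambda>n. H1_norm (Omega L) (\<lambda>x. X n x - u x)) \<longlonglongrightarrow> 0"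
    using H1_complete[of X "(0, 0)" "(L, L)"] Vc_H1[OF X] Cauchy unfolding Omega_eq_box by blast
  note trace_limit = has_trace_limit[where a = "(0, 0)" and b = "(L, L)", folded Omega_eq_box]
  have "Cauchy (\<lambda>n. bval L (X n))"
    unfolding Cauchy_def
  proof (intro allI impI)
    fix e :: real assume e: "e > 0"
    define K where "K = (1 + L) / L"
    have K: "K > 0" using L by (simp add: K_def)
    obtain N where N: "\<And>m n. m \<ge> N \<Longrightarrow> n \<ge> N \<Longrightarrow> H1_norm (Omega L) (\<lambda>x. X m x - X n x) < e / K"
      using Cauchy[of "e / K"] e K by auto
    have "dist (bval L (X m)) (bval L (X n)) < e" if "m \<ge> N" "n \<ge> N" for m n
    proof -
      have "dist (bval L (X m)) (bval L (X n)) \<le> K * H1_norm (Omega L) (\<lambda>x. X m x - X n x)"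
        using bval_bound[OF L Vc_diff(1)[OF L X X], of m n] Vc_diff(2)[OF L X X, of m n]
        by (simp add: dist_real_def K_def)
      also have "\<dots> < e" using N[OF that] K by (simp add: field_simps)
      finally show ?thesis .
    qed
    then show "\<exists>N. \<forall>m\<ge>N. \<forall>n\<ge>N. dist (bval L (X m)) (bval L (X n)) < e" by blast
  qed
  then obtain c where c: "(\<lambda>n. bval L (X n)) \<longlonglongrightarrow> c"
    using Cauchy_convergent_iff convergent_def by blast
  have "(\<lambda>n. \<bar>bval L (X n) - c\<bar> * sqrt L) \<longlonglongrightarrow> \<bar>c - c\<bar> * sqrt L"
    by (intro tendsto_intros c)
  then have "(\<lambda>n. L2_norm (ds L 0) (\<lambda>_. bval L (X n) - c)) \<longlonglongrightarrow> 0"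
    using L by (simp add: L2_norm_const_ds)
  then have 1: "has_trace (Omega L) (ds L 0) u (\<lambda>_. c)"
    by (rule trace_limit[OF has_trace_bval[OF L X] u(1) const_L2_ds[OF L] u(2)])
  have "has_trace (Omega L) (ds L L) (X n) (\<lambda>_. 0)" for n
    using X Vc_iff[OF L] by blast
  then have "has_trace (Omega L) (ds L L) u (\<lambda>_. 0)"
    by (rule trace_limit[OF _ u(1) const_L2_ds[OF L] u(2)]) (simp add: L2_norm_def)
  with 1 have "u \<in> Vc L" unfolding Vc_iff[OF L] by blast
  with u(2) that show ?thesis by blast
qed

section \<open>The form and the functional in terms of boundary constants\<close>

text \<open>\<open>trace\<close> is one chosen representative, so it agrees with the constant only
  up to a null set; its measurability is required for replacing it under an integral.\<close>

lemma AE_trace_eq_bval: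
  assumes L: "L > 0" and u: "u \<in> Vc L"
  shows "AE s in ds1 L. trace (Omega L) (ds1 L) u s = bval L u"
    and "trace (Omega L) (ds1 L) u \<in> borel_measurable (ds1 L)"
proof -
  have t: "has_trace (Omega L) (ds L 0) u (trace (Omega L) (ds L 0) u)"
    unfolding trace_def by (rule someI[of "has_trace (Omega L) (ds L 0) u", OF has_trace_bval[OF L u]])
  show "AE s in ds1 L. trace (Omega L) (ds1 L) u s = bval L u"
    unfolding ds1_eq[OF L] using L by (intro has_trace_unique[OF L _ t has_trace_bval[OF L u]]) simp
  show "trace (Omega L) (ds1 L) u \<in> borel_measurable (ds1 L)"
    unfolding ds1_eq[OF L] using t by (auto simp: has_trace_def L2_def)
qed

lemma form_L_eq:
  assumes L: "L > 0" and v: "v \<in> Vc L"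
  shows "form_L L R f U v = (\<integral>z. f z * v z \<partial>lebesgue_on (Omega L)) + U / R * bval L v"
proof -
  have "(\<integral>s. trace (Omega L) (ds1 L) v s \<partial>ds1 L) = (\<integral>s. bval L v \<partial>ds1 L)"
    using AE_trace_eq_bval[OF L v] by (intro integral_cong_AE) auto
  \<comment> \<open>The length of the side appears here and cancels \<open>length1 L\<close> in the
    definition of the functional.\<close>
  also have "\<dots> = L * bval L v" using L by (simp add: ds1_eq measure_ds)
  finally show ?thesis using L by (simp add: form_L_def length1_eq)
qed

lemma form_a_eq:
  assumes L: "L > 0" and u: "u \<in> Vc L" and v: "v \<in> Vc L"
  shows "form_a L \<sigma> R u v = (\<integral>z. \<sigma> z * (weak_gradient (Omega L) u z \<bullet> weak_gradient (Omega L) v z)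
    \<partial>lebesgue_on (Omega L)) + bval L u * bval L v / R"
proof -
  have "(\<integral>s. trace (Omega L) (ds1 L) u s * trace (Omega L) (ds1 L) v s \<partial>ds1 L)
      = (\<integral>s. bval L u * bval L v \<partial>ds1 L)"
  proof (rule integral_cong_AE)
    show "AE s in ds1 L. trace (Omega L) (ds1 L) u s * trace (Omega L) (ds1 L) v s = bval L u * bval L v"
      using AE_trace_eq_bval(1)[OF L u] AE_trace_eq_bval(1)[OF L v] by eventually_elim simp
  qed (intro borel_measurable_times AE_trace_eq_bval L u v borel_measurable_const)+
  also have "\<dots> = L * (bval L u * bval L v)" using L by (simp add: ds1_eq measure_ds)
  finally show ?thesis using L by (simp add: form_a_def length1_eq)
qed

lemma form_L_bound:
  assumes L: "L > 0" and R: "R > 0" and f: "f \<in> L2 (lebesgue_on (Omega L))" and v: "v \<in> Vc L"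
  shows "\<bar>form_L L R f U v\<bar> \<le> (1 + (1 + L) / (L * R)) *
    (L2_norm (lebesgue_on (Omega L)) f + \<bar>U\<bar>) * H1_norm (Omega L) v"
proof -
  let ?F = "L2_norm (lebesgue_on (Omega L)) f" and ?N = "H1_norm (Omega L) v" and ?K = "(1 + L) / (L * R)"
  have K: "0 \<le> ?K" using L R by simp
  have "\<bar>\<integral>z. f z * v z \<partial>lebesgue_on (Omega L)\<bar> \<le> ?F * L2_norm (lebesgue_on (Omega L)) v"
    by (rule L2_Cauchy_Schwarz_mult[OF f H1_imp_L2[OF Vc_H1[OF v]]])
  also have "\<dots> \<le> ?F * ?N" by (intro mult_left_mono L2_norm_le_H1_norm) simp
  finally have 1: "\<bar>\<integral>z. f z * v z \<partial>lebesgue_on (Omega L)\<bar> \<le> ?F * ?N" .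
  have "\<bar>U / R * bval L v\<bar> = \<bar>U\<bar> / R * \<bar>bval L v\<bar>" using R by (simp add: abs_mult)
  also have "\<dots> \<le> \<bar>U\<bar> / R * ((1 + L) / L * ?N)"
    using R by (intro mult_left_mono bval_bound[OF L v]) simp
  also have "\<dots> = ?K * (\<bar>U\<bar> * ?N)" using L R by (simp add: field_simps)
  finally have 2: "\<bar>U / R * bval L v\<bar> \<le> ?K * (\<bar>U\<bar> * ?N)" .
  have "\<bar>form_L L R f U v\<bar> \<le> ?F * ?N + ?K * (\<bar>U\<bar> * ?N)"
    unfolding form_L_eq[OF L v] using 1 2 by linarith
  \<comment> \<open>Adding the missing cross terms makes the expression factor as (1 + K) (F + |U|)
    N, the form of the data norm in \<open>well_posed\<close>.\<close>
  also have "\<dots> \<le> (?F * ?N + ?K * (?F * ?N)) + (\<bar>U\<bar> * ?N + ?K * (\<bar>U\<bar> * ?N))"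
    using mult_nonneg_nonneg[OF K mult_nonneg_nonneg[of ?F ?N]] by simp
  also have "\<dots> = (1 + ?K) * (?F + \<bar>U\<bar>) * ?N" by (simp only: distrib_left distrib_right mult_1_left mult.assoc)
  finally show ?thesis .
qed

lemma form_L_lincomb:
  assumes L: "L > 0" and f: "f \<in> L2 (lebesgue_on (Omega L))" and u: "u \<in> Vc L" and v: "v \<in> Vc L"
  shows "form_L L R f U (\<lambda>x. u x + t * v x) = form_L L R f U u + t * form_L L R f U v"
proof -
  have int: "integrable (lebesgue_on (Omega L)) (\<lambda>z. f z * u z)" "integrable (lebesgue_on (Omega L)) (\<lambda>z. f z * v z)"
    by (intro L2_integrable_mult f H1_imp_L2 Vc_H1 u v)+
  have "(\<integral>z. f z * (u z + t * v z) \<partial>lebesgue_on (Omega L))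
      = (\<integral>z. f z * u z + t * (f z * v z) \<partial>lebesgue_on (Omega L))"
    by (intro Bochner_Integration.integral_cong) (auto simp: algebra_simps)
  also have "\<dots> = (\<integral>z. f z * u z \<partial>lebesgue_on (Omega L)) + t * (\<integral>z. f z * v z \<partial>lebesgue_on (Omega L))"
    using int by simp
  finally show ?thesis
    by (simp add: form_L_eq[OF L] Vc_lincomb[OF L u v] u v algebra_simps)
qed

lemma form_L_diff_data:
  assumes L: "L > 0" and f: "f \<in> L2 (lebesgue_on (Omega L))" and g: "g \<in> L2 (lebesgue_on (Omega L))"
    and v: "v \<in> Vc L"
  shows "form_L L R (\<lambda>z. f z - g z) (U - W) v = form_L L R f U v - form_L L R g W v"
proof -
  have "integrable (lebesgue_on (Omega L)) (\<lambda>z. f z * v z)" "integrable (lebesgue_on (Omega L)) (\<lambda>z. g z * v z)"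
    by (intro L2_integrable_mult f g H1_imp_L2 Vc_H1 v)+
  then show ?thesis
    by (simp add: form_L_eq[OF L v] left_diff_distrib diff_divide_distrib)
qed

section \<open>Coercivity, existence and stability\<close>

context
  fixes L R m M :: real and \<sigma> :: "real \<times> real \<Rightarrow> real"
  assumes L: "L > 0" and R: "R > 0" and m: "m > 0"
    and \<sigma>_meas: "\<sigma> \<in> borel_measurable (lebesgue_on (Omega L))"
    and \<sigma>_bounds: "AE z in lebesgue_on (Omega L). m \<le> \<sigma> z \<and> \<sigma> z \<le> M"
begin

abbreviation (input) \<mu> where "\<mu> \<equiv> lebesgue_on (Omega L)"
abbreviation (input) wg where "wg \<equiv> weak_gradient (Omega L)"

lemma wg_L2: "u \<in> Vc L \<Longrightarrow> wg u \<in> L2 \<mu>"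
  by (intro weak_gradient_props Vc_H1)

lemma integrable_\<sigma>_inner:
  assumes "u \<in> Vc L" "v \<in> Vc L"
  shows "integrable \<mu> (\<lambda>z. \<sigma> z * (wg u z \<bullet> wg v z))"
proof -
  \<comment> \<open>As \<sigma> is at least m > 0 almost everywhere, its upper bound also bounds its
    absolute value.\<close>
  have "AE z in \<mu>. \<bar>\<sigma> z\<bar> \<le> M" using \<sigma>_bounds by eventually_elim (use m in auto)
  from L2_integrable_inner[OF L2_bounded_mult[OF wg_L2[OF assms(1)] \<sigma>_meas this] wg_L2[OF assms(2)]]
  show ?thesis by simp
qed

lemma form_a_sym:
  assumes "u \<in> Vc L" "v \<in> Vc L"
  shows "form_a L \<sigma> R u v = form_a L \<sigma> R v u"
  using assms by (simp add: form_a_eq[OF L] inner_commute mult.commute)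

lemma form_a_lincomb:
  assumes u: "u \<in> Vc L" and v: "v \<in> Vc L" and w: "w \<in> Vc L"
  shows "form_a L \<sigma> R (\<lambda>x. u x + t * v x) w = form_a L \<sigma> R u w + t * form_a L \<sigma> R v w"
proof -
  note uv = Vc_lincomb(1)[OF L u v, of t]
  have "(\<integral>z. \<sigma> z * (wg (\<lambda>x. u x + t * v x) z \<bullet> wg w z) \<partial>\<mu>)
      = (\<integral>z. \<sigma> z * (wg u z \<bullet> wg w z) + t * (\<sigma> z * (wg v z \<bullet> wg w z)) \<partial>\<mu>)"
  proof (rule integral_cong_AE)
    show "AE z in \<mu>. \<sigma> z * (wg (\<lambda>x. u x + t * v x) z \<bullet> wg w z)
        = \<sigma> z * (wg u z \<bullet> wg w z) + t * (\<sigma> z * (wg v z \<bullet> wg w z))"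
      using H1_lincomb(2)[OF Vc_H1[OF u, unfolded Omega_eq_box] Vc_H1[OF v, unfolded Omega_eq_box], of t]
      unfolding Omega_eq_box by eventually_elim (simp add: inner_add_left distrib_left)
    show "(\<lambda>z. \<sigma> z * (wg (\<lambda>x. u x + t * v x) z \<bullet> wg w z)) \<in> borel_measurable \<mu>"
      by (rule borel_measurable_integrable[OF integrable_\<sigma>_inner[OF uv w]])
    show "(\<lambda>z. \<sigma> z * (wg u z \<bullet> wg w z) + t * (\<sigma> z * (wg v z \<bullet> wg w z))) \<in> borel_measurable \<mu>"
      using borel_measurable_integrable[OF integrable_\<sigma>_inner[OF u w]]
        borel_measurable_integrable[OF integrable_\<sigma>_inner[OF v w]] by measurable
  qed
  also have "\<dots> = (\<integral>z. \<sigma> z * (wg u z \<bullet> wg w z) \<partial>\<mu>) + t * (\<integral>z. \<sigma> z * (wg v z \<bullet> wg w z) \<partial>\<mu>)"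
    using integrable_\<sigma>_inner[OF u w] integrable_\<sigma>_inner[OF v w] by simp
  finally show ?thesis
    by (simp add: form_a_eq[OF L] Vc_lincomb[OF L u v] u v w algebra_simps add_divide_distrib)
qed

lemma form_a_diff:
  assumes u: "u \<in> Vc L" and v: "v \<in> Vc L" and w: "w \<in> Vc L"
  shows "form_a L \<sigma> R (\<lambda>x. u x - v x) w = form_a L \<sigma> R u w - form_a L \<sigma> R v w"
  using form_a_lincomb[OF assms, of "-1"] by simp

text \<open>The Poincare inequality on x = L bounds the squared H1 norm by 1 + L^2 times the squared
  norm of the gradient, and \<sigma> \<ge> m controls the latter. The boundary term is nonnegative
  and is dropped.\<close>

lemma form_a_coercive:
  assumes u: "u \<in> Vc L"
  shows "m / (1 + L\<^sup>2) * (H1_norm (Omega L) u)\<^sup>2 \<le> form_a L \<sigma> R u u"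
proof -
  have "L2_norm \<mu> u \<le> L * L2_norm \<mu> (wg u)"
    using Poincare_inequality[OF L, of L u] u L unfolding Vc_iff[OF L] by simp
  then have "(L2_norm \<mu> u)\<^sup>2 \<le> (L * L2_norm \<mu> (wg u))\<^sup>2" by (intro power_mono) auto
  then have "(H1_norm (Omega L) u)\<^sup>2 \<le> (1 + L\<^sup>2) * (L2_norm \<mu> (wg u))\<^sup>2"
    by (simp add: H1_norm_def power_mult_distrib algebra_simps)
  moreover have p: "0 < 1 + L\<^sup>2" by (simp add: add_pos_nonneg)
  ultimately have "m / (1 + L\<^sup>2) * (H1_norm (Omega L) u)\<^sup>2 \<le> m / (1 + L\<^sup>2) * ((1 + L\<^sup>2) * (L2_norm \<mu> (wg u))\<^sup>2)"
    using m by (intro mult_left_mono) auto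
  also have "\<dots> = m * (L2_norm \<mu> (wg u))\<^sup>2" using p by simp
  also have "\<dots> = (\<integral>z. m * (norm (wg u z))\<^sup>2 \<partial>\<mu>)" by (simp add: L2_norm_square)
  also have "\<dots> \<le> (\<integral>z. \<sigma> z * (wg u z \<bullet> wg u z) \<partial>\<mu>)"
  proof (rule integral_mono_AE)
    show "integrable \<mu> (\<lambda>z. m * (norm (wg u z))\<^sup>2)"
      by (intro integrable_mult_right L2_integrable_square wg_L2 u)
    show "AE z in \<mu>. m * (norm (wg u z))\<^sup>2 \<le> \<sigma> z * (wg u z \<bullet> wg u z)"
      using \<sigma>_bounds by eventually_elim (simp add: power2_norm_eq_inner mult_right_mono)
  qed (rule integrable_\<sigma>_inner[OF u u])
  also have "\<dots> \<le> form_a L \<sigma> R u u"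
    using R by (simp add: form_a_eq[OF L u u])
  finally show ?thesis .
qed

text \<open>Turns H1 convergence into energy convergence, as the completeness assumption of
  \<open>symmetric_form_represents\<close> demands. Writing \<open>\<bar>M\<bar>\<close> makes the
  coefficient visibly nonnegative; the second summand comes from \<open>bval_bound\<close>.\<close>

lemma form_a_bounded:
  assumes u: "u \<in> Vc L"
  shows "form_a L \<sigma> R u u \<le> (\<bar>M\<bar> + ((1 + L) / L)\<^sup>2 / R) * (H1_norm (Omega L) u)\<^sup>2"
proof -
  have "(\<integral>z. \<sigma> z * (wg u z \<bullet> wg u z) \<partial>\<mu>) \<le> (\<integral>z. \<bar>M\<bar> * (norm (wg u z))\<^sup>2 \<partial>\<mu>)"
  proof (rule integral_mono_AE)
    show "integrable \<mu> (\<lambda>z. \<bar>M\<bar> * (norm (wg u z))\<^sup>2)"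
      by (intro integrable_mult_right L2_integrable_square wg_L2 u)
    show "AE z in \<mu>. \<sigma> z * (wg u z \<bullet> wg u z) \<le> \<bar>M\<bar> * (norm (wg u z))\<^sup>2"
      using \<sigma>_bounds by eventually_elim (auto simp: power2_norm_eq_inner intro!: mult_right_mono)
  qed (rule integrable_\<sigma>_inner[OF u u])
  also have "\<dots> = \<bar>M\<bar> * (L2_norm \<mu> (wg u))\<^sup>2" by (simp add: L2_norm_square)
  also have "\<dots> \<le> \<bar>M\<bar> * (H1_norm (Omega L) u)\<^sup>2"
    by (intro mult_left_mono power_mono L2_norm_le_H1_norm) auto
  finally have 1: "(\<integral>z. \<sigma> z * (wg u z \<bullet> wg u z) \<partial>\<mu>) \<le> \<bar>M\<bar> * (H1_norm (Omega L) u)\<^sup>2" .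
  have "\<bar>bval L u\<bar>\<^sup>2 \<le> ((1 + L) / L * H1_norm (Omega L) u)\<^sup>2"
    by (intro power_mono bval_bound[OF L u]) simp
  then have "bval L u * bval L u \<le> ((1 + L) / L)\<^sup>2 * (H1_norm (Omega L) u)\<^sup>2"
    by (simp only: power_mult_distrib power2_abs) (simp only: power2_eq_square)
  from divide_right_mono[OF this, of R]
  have "bval L u * bval L u / R \<le> ((1 + L) / L)\<^sup>2 / R * (H1_norm (Omega L) u)\<^sup>2"
    using R by simp
  with 1 show ?thesis by (simp add: form_a_eq[OF L u u] distrib_right)
qed

lemma form_a_nonneg: "u \<in> Vc L \<Longrightarrow> 0 \<le> form_a L \<sigma> R u u"
  using m by (intro order_trans[OF _ form_a_coercive]) auto

text \<open>By coercivity and boundedness the energy norm and the H1 norm are equivalent on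
  \<open>Vc L\<close>, so the bound on the functional and the completeness of \<open>Vc L\<close>
  carry over to the energy.\<close>

lemma solution_exists:
  assumes f: "f \<in> L2 \<mu>"
  shows "\<exists>\<Phi>. is_solution L \<sigma> R f U \<Phi>"
proof -
  define \<alpha> where "\<alpha> = m / (1 + L\<^sup>2)"
  have \<alpha>: "\<alpha> > 0" using m by (simp add: \<alpha>_def add_pos_nonneg)
  define B where "B = (1 + (1 + L) / (L * R)) * (L2_norm \<mu> f + \<bar>U\<bar>)"
  have B: "0 \<le> B" using L R by (simp add: B_def)
  define K where "K = \<bar>M\<bar> + ((1 + L) / L)\<^sup>2 / R"
  have H1_le: "H1_norm (Omega L) v \<le> sqrt (form_a L \<sigma> R v v) / sqrt \<alpha>" if "v \<in> Vc L" for v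
  proof -
    have "(H1_norm (Omega L) v)\<^sup>2 \<le> form_a L \<sigma> R v v / \<alpha>"
      using form_a_coercive[OF that] \<alpha> by (simp add: \<alpha>_def[symmetric] field_simps)
    then show ?thesis by (simp add: real_le_rsqrt flip: real_sqrt_divide)
  qed
  have "\<exists>u\<in>Vc L. \<forall>v\<in>Vc L. form_a L \<sigma> R u v = form_L L R f U v"
  proof (rule symmetric_form_represents)
    show "(\<lambda>_. 0) \<in> Vc L" by (rule zero_in_Vc[OF L])
    show "\<bar>form_L L R f U v\<bar> \<le> B / sqrt \<alpha> * sqrt (form_a L \<sigma> R v v)" if v: "v \<in> Vc L" for v
      using form_L_bound[OF L R f v, of U] mult_left_mono[OF H1_le[OF v] B] by (simp add: B_def)
  next
    fix X :: "nat \<Rightarrow> real \<times> real \<Rightarrow> real"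
    assume X: "\<And>n. X n \<in> Vc L"
      and Cauchy: "\<And>e. 0 < e \<Longrightarrow>
        \<exists>N. \<forall>m\<ge>N. \<forall>n\<ge>N. form_a L \<sigma> R (\<lambda>x. X m x - X n x) (\<lambda>x. X m x - X n x) < e"
    obtain u where u: "u \<in> Vc L" "(\<lambda>n. H1_norm (Omega L) (\<lambda>x. X n x - u x)) \<longlonglongrightarrow> 0"
    proof (rule Vc_complete[OF L X])
      fix e :: real assume e: "e > 0"
      then have "0 < \<alpha> * e\<^sup>2" using \<alpha> by simp
      \<comment> \<open>By coercivity the energy threshold \<alpha> e^2 corresponds to the H1
        threshold e.\<close>
      from Cauchy[OF this] obtain N where N: "\<And>m n. m \<ge> N \<Longrightarrow> n \<ge> N \<Longrightarrow>
          form_a L \<sigma> R (\<lambda>x. X m x - X n x) (\<lambda>x. X m x - X n x) < \<alpha> * e\<^sup>2" by blast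
      have "H1_norm (Omega L) (\<lambda>x. X m x - X n x) < e" if "m \<ge> N" "n \<ge> N" for m n
      proof (rule power2_less_imp_less)
        have "\<alpha> * (H1_norm (Omega L) (\<lambda>x. X m x - X n x))\<^sup>2 < \<alpha> * e\<^sup>2"
          using form_a_coercive[OF Vc_diff(1)[OF L X X], of m n] N[OF that] by (simp add: \<alpha>_def)
        then show "(H1_norm (Omega L) (\<lambda>x. X m x - X n x))\<^sup>2 < e\<^sup>2" using \<alpha> by simp
      qed (use e in simp)
      then show "\<exists>N. \<forall>m\<ge>N. \<forall>n\<ge>N. H1_norm (Omega L) (\<lambda>x. X m x - X n x) < e" by blast
    qed
    have "(\<lambda>n. form_a L \<sigma> R (\<lambda>x. X n x - u x) (\<lambda>x. X n x - u x)) \<longlonglongrightarrow> 0"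
    proof (rule tendsto_sandwich[OF _ _ tendsto_const])
      show "(\<lambda>n. K * (H1_norm (Omega L) (\<lambda>x. X n x - u x))\<^sup>2) \<longlonglongrightarrow> 0"
        using tendsto_mult_left[OF tendsto_power[OF u(2), of 2], of K] by simp
    qed (use form_a_nonneg[OF Vc_diff(1)[OF L X u(1)]] form_a_bounded[OF Vc_diff(1)[OF L X u(1)]]
        in \<open>simp_all add: K_def\<close>)
    with u(1) show "\<exists>u\<in>Vc L. (\<lambda>n. form_a L \<sigma> R (\<lambda>x. X n x - u x) (\<lambda>x. X n x - u x)) \<longlonglongrightarrow> 0" by blast
  qed (fact Vc_lincomb(1)[OF L] form_a_sym form_a_lincomb form_a_nonneg form_L_lincomb[OF L f])+
  then show ?thesis unfolding is_solution_def by blast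
qed

text \<open>The difference of the solutions solves the problem for the difference of the data and is
  itself an admissible test function. Testing with it bounds its energy by the functional; the
  constant is the inverse coercivity constant times that of \<open>form_L_bound\<close>.\<close>

lemma solution_stable:
  assumes f: "f \<in> L2 \<mu>" and f': "f' \<in> L2 \<mu>"
    and \<Phi>: "is_solution L \<sigma> R f U \<Phi>" and \<Phi>': "is_solution L \<sigma> R f' U' \<Phi>'"
  shows "H1_norm (Omega L) (\<lambda>z. \<Phi> z - \<Phi>' z)
    \<le> (1 + L\<^sup>2) / m * (1 + (1 + L) / (L * R)) * (L2_norm \<mu> (\<lambda>z. f z - f' z) + \<bar>U - U'\<bar>)"
proof -
  define w where "w = (\<lambda>z. \<Phi> z - \<Phi>' z)"
  define N where "N = H1_norm (Omega L) w"
  define D where "D = (1 + (1 + L) / (L * R)) * (L2_norm \<mu> (\<lambda>z. f z - f' z) + \<bar>U - U'\<bar>)"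
  have V: "\<Phi> \<in> Vc L" "\<Phi>' \<in> Vc L" using \<Phi> \<Phi>' by (auto simp: is_solution_def)
  then have w: "w \<in> Vc L" unfolding w_def by (rule Vc_diff(1)[OF L])
  have D: "0 \<le> D" using L R by (simp add: D_def)
  have "form_a L \<sigma> R w w = form_L L R f U w - form_L L R f' U' w"
    using form_a_diff[OF V w] \<Phi> \<Phi>' w unfolding is_solution_def by (simp add: w_def)
  also have "\<dots> = form_L L R (\<lambda>z. f z - f' z) (U - U') w"
    by (rule form_L_diff_data[OF L f f' w, symmetric])
  also have "\<dots> \<le> D * N"
    using form_L_bound[OF L R L2_diff[OF f f'] w, of "U - U'"] by (simp add: D_def N_def)
  finally have "m / (1 + L\<^sup>2) * N\<^sup>2 \<le> D * N"
    using form_a_coercive[OF w] by (simp add: N_def)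
  have p: "0 < m / (1 + L\<^sup>2)" using m by (simp add: add_pos_nonneg)
  \<comment> \<open>One factor N is cancelled; if N = 0 the claim is just
    \<open>0 \<le> D\<close>.\<close>
  have "m / (1 + L\<^sup>2) * N \<le> D"
  proof (cases "N = 0")
    case True
    with D show ?thesis by simp
  next
    case False
    then have "0 < N" using H1_norm_nonneg[of "Omega L" w] by (simp add: N_def less_le)
    moreover have "m / (1 + L\<^sup>2) * N * N \<le> D * N"
      using \<open>m / (1 + L\<^sup>2) * N\<^sup>2 \<le> D * N\<close> by (simp only: power2_eq_square mult.assoc)
    ultimately show ?thesis by (rule mult_right_le_imp_le[rotated])
  qed
  then have "N \<le> D / (m / (1 + L\<^sup>2))" using p by (simp only: pos_le_divide_eq[OF p] mult.commute[of N])
  then show ?thesis by (simp add: N_def w_def D_def mult.commute mult.left_commute)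
qed

lemma well_posed_if_bounded_conductivity: "well_posed L \<sigma> R"
  unfolding well_posed_def
proof (intro conjI ballI allI impI)
  fix f :: "real \<times> real \<Rightarrow> real" and U assume "f \<in> L2 \<mu>"
  then show "\<exists>\<Phi>. is_solution L \<sigma> R f U \<Phi>" by (rule solution_exists)
next
  fix f :: "real \<times> real \<Rightarrow> real" and U \<Phi> \<Phi>'
  assume f: "f \<in> L2 \<mu>" and \<Phi>: "is_solution L \<sigma> R f U \<Phi>" "is_solution L \<sigma> R f U \<Phi>'"
  \<comment> \<open>Equal data make the right-hand side of the stability estimate zero.\<close>
  have "H1_norm (Omega L) (\<lambda>z. \<Phi> z - \<Phi>' z) \<le> 0"
    using solution_stable[OF f f \<Phi>] by (simp add: L2_norm_def)
  then have "L2_norm \<mu> (\<lambda>z. \<Phi> z - \<Phi>' z) = 0"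
    using L2_norm_le_H1_norm(1)[of "Omega L" "\<lambda>z. \<Phi> z - \<Phi>' z"]
    by (intro order_antisym) (auto intro: order_trans)
  moreover have "(\<lambda>z. \<Phi> z - \<Phi>' z) \<in> L2 \<mu>"
    using \<Phi> by (intro L2_diff H1_imp_L2 Vc_H1) (auto simp: is_solution_def)
  ultimately have "AE z in \<mu>. \<Phi> z - \<Phi>' z = 0" by (intro L2_norm_eq_0_imp_AE)
  then show "AE z in \<mu>. \<Phi> z = \<Phi>' z" by eventually_elim simp
next
  show "\<exists>C. \<forall>f\<in>L2 \<mu>. \<forall>f'\<in>L2 \<mu>. \<forall>U U' \<Phi> \<Phi>'.
      is_solution L \<sigma> R f U \<Phi> \<longrightarrow> is_solution L \<sigma> R f' U' \<Phi>' \<longrightarrow>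
      H1_norm (Omega L) (\<lambda>z. \<Phi> z - \<Phi>' z) \<le> C * (L2_norm \<mu> (\<lambda>z. f z - f' z) + \<bar>U - U'\<bar>)"
    using solution_stable by blast
qed

end

theorem theorem1:
  fixes L R :: real and \<sigma> :: "real \<times> real \<Rightarrow> real"
  assumes "L > 0" and "R > 0" and "positive_conductivity L \<sigma>"
  shows "well_posed L \<sigma> R"
  using assms(3) well_posed_if_bounded_conductivity[OF assms(1,2)] unfolding positive_conductivity_def by blast

end
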